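(* Let $M\ge 1$ be an integer, $\alpha>0$, $\rho:\{1,2,\dots\}\to(0,\infty)$, and let $F_0$ be a probability distribution on $\mathbb{R}$ with density $f_0$. Let $F\sim\mathcal{PT}_M(\alpha,\rho,F_0)$ be a finite Pólya tree random distribution with random density $f$ and branching probabilities $Y_{mj}$. Then the Kullback-Leibler divergence between $f$ and $f_0$, $$\mathrm{KL}(f\,||\,f_0)=\sum_{m=1}^M\sum_{j=1}^{2^m}(\log Y_{mj})\prod_{k=1}^{m}Y_{m-k+1,\,j_{m-k+1}^{(m,j)}}+M\log 2,$$ has mean and variance given by $$\mathrm{E}\{\mathrm{KL}(f\,||\,f_0)\}=\sum_{m=1}^M\left\{\psi_0(\alpha\rho(m)+1)-\psi_0(2\alpha\rho(m)+1)+\log 2\right\}$$ and $\mathrm{Var}\{\mathrm{KL}(f\,||\,f_0)\}=A+B$, where $$A=\sum_{m=1}^M\left[\left\{\prod_{k=1}^m\left(\frac{\alpha\rho(k)+1}{2\alpha\rho(k)+1}\right)\right\}\lambda_5(m)-\left(\frac{1}{2}\right)^m\lambda_2^2(m)\right],$$ $$\begin{aligned}B=\sum_{m=1}^M\Bigg(&\left(\frac{\alpha\rho(m)}{2\alpha\rho(m)+1}\right)\left\{\prod_{k=1}^{m-1}\left(\frac{\alpha\rho(k)+1}{2\alpha\rho(k)+1}\right)\right\}\lambda_6(m)-\left(\frac{1}{2}\right)^m\lambda_2^2(m)\\ &+\sum_{j=1}^{m-1}\left[\left(\frac{\alpha\rho(j)}{2\alpha\rho(j)+1}\right)\left\{\prod_{k=1}^{j-1}\left(\frac{\alpha\rho(k)+1}{2\alpha\rho(k)+1}\right)\right\}\lambda_2^2(m)-\left(\frac{1}{2}\right)^j\lambda_2^2(m)\right]\\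 &+2\left\{\prod_{k=1}^{m-1}\left(\frac{\alpha\rho(k)+1}{2\alpha\rho(k)+1}\right)\right\}\sum_{j=m+1}^{M}\left\{\left(\frac{\alpha\rho(m)+1}{2\alpha\rho(m)+1}\right)\lambda_3(m)\lambda_2(j)\right.\\ &\qquad\left.+\left(\frac{\alpha\rho(m)}{2\alpha\rho(m)+1}\right)\lambda_4(m)\lambda_2(j)-\lambda_2(m)\lambda_2(j)\right\}\Bigg),\end{aligned}$$ with $$\lambda_2(m)=\psi_0(\alpha\rho(m)+1)-\psi_0(2\alpha\rho(m)+1),$$ $$\lambda_3(m)=\psi_0(\alpha\rho(m)+2)-\psi_0(2\alpha\rho(m)+2),$$ $$\lambda_4(m)=\psi_0(\alpha\rho(m)+1)-\psi_0(2\alpha\rho(m)+2),$$ $$\lambda_5(m)=\psi_1(\alpha\rho(m)+2)-\psi_1(2\alpha\rho(m)+2)+\left\{\psi_0(\alpha\rho(m)+2)-\psi_0(2\alpha\rho(m)+2)\right\}^2,$$ $$\lambda_6(m)=\left\{\psi_0(\alpha\rho(m)+1)-\psi_0(2\alpha\rho(m)+2)\right\}^2-\psi_1(2\alpha\rho(m)+2).$$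
   Context: $\psi_0(x)=\frac{d}{dx}\log\Gamma(x)$ is the digamma function and $\psi_1(x)=\frac{d^2}{dx^2}\log\Gamma(x)$ the trigamma function. Empty products equal $1$, empty sums equal $0$, and $\lambda_2^2(m)=(\lambda_2(m))^2$. For densities $f,g$ on $\mathbb{R}$, $\mathrm{KL}(f\,||\,g)=\int \log\{f(x)/g(x)\}f(x)\,dx$. Finite Pólya tree $\mathcal{PT}_M(\alpha,\rho,F_0)$: for $m=1,\dots,M$ and $j=1,\dots,2^m$ let $B_{mj}=\left(F_0^{-1}\left(\frac{j-1}{2^m}\right),F_0^{-1}\left(\frac{j}{2^m}\right)\right]$, with $F_0^{-1}(0)=-\infty$ and $F_0^{-1}(1)=\infty$, so that $B_{mj}$ is the disjoint union of $B_{m+1,2j-1}$ and $B_{m+1,2j}$. Let $Y_{m,2j-1}$, $m=1,\dots,M$, $j=1,\dots,2^{m-1}$, be independent random variables with $Y_{m,2j-1}\sim\mathrm{Beta}(\alpha\rho(m),\alpha\rho(m))$, and let $Y_{m,2j}=1-Y_{m,2j-1}$. These are branching probabilities, and $F(B_{mj})=\prod_{k=1}^m Y_{m-k+1,\,j_{m-k+1}^{(m,j)}}$, where the ancestor indices are defined by $j_m^{(m,j)}=j$ and $j_{k-1}^{(m,j)}=\lceil j_k^{(m,j)}/2\rceil$. The random distribution $F$ has density $f(x)=\left(\prod_{m=1}^M Y_{m,j_m(x)}\right)2^M f_0(x)$, where $j_m(x)$ is the index $j$ such that $x\in B_{mj}$. *)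

theory Defs
  imports "HOL-Probability.Probability"
begin

definition beta_density :: "real \<Rightarrow> real \<Rightarrow> real \<Rightarrow> real" where
  "beta_density a b x =
     (if 0 < x \<and> x < 1 then x powr (a - 1) * (1 - x) powr (b - 1) / Beta a b else 0)"

definition has_density :: "real measure \<Rightarrow> (real \<Rightarrow> real) \<Rightarrow> bool" where
  "has_density F f \<longleftrightarrow>
     f \<in> borel_measurable borel \<and> (\<forall>x. 0 \<le> f x) \<and> F = density lborel (\<lambda>x. ennreal (f x))"

definition kl_integrand :: "(real \<Rightarrow> real) \<Rightarrow> (real \<Rightarrow> real) \<Rightarrow> real \<Rightarrow> real" where
  "kl_integrand f g x = ln (f x / g x) * f x"

text \<open>The library conventions \<open>x / 0 = 0\<close> and \<open>ln 0 = 0\<close> implement the usual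
  convention \<open>0 log 0 = 0\<close> here; for densities, the integral is the Kullback-Leibler divergence
  when \<open>g x = 0\<close> implies \<open>f x = 0\<close> (almost everywhere) and the integrand is integrable.\<close>

definition kl :: "(real \<Rightarrow> real) \<Rightarrow> (real \<Rightarrow> real) \<Rightarrow> real" where
  "kl f g = (\<integral>x. kl_integrand f g x \<partial>lborel)"

text \<open>The values at 0 and 1 are fixed to be infinite even if \<open>F0\<close> has bounded support.\<close>

definition quantile :: "real measure \<Rightarrow> real \<Rightarrow> ereal" where
  "quantile F0 p =
     (if p \<le> 0 then -\<infinity> else if 1 \<le> p then \<infinity> else ereal (Inf {x. p \<le> cdf F0 x}))"

definition cell :: "real measure \<Rightarrow> nat \<Rightarrow> nat \<Rightarrow> real set" where
  "cell F0 m j =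
     {x. quantile F0 ((real j - 1) / 2 ^ m) < ereal x \<and> ereal x \<le> quantile F0 (real j / 2 ^ m)}"

definition cell_index :: "real measure \<Rightarrow> nat \<Rightarrow> real \<Rightarrow> nat" where
  "cell_index F0 m x = (THE j. j \<in> {1..2 ^ m} \<and> x \<in> cell F0 m j)"

text \<open>\<open>ancestor m j k\<close> is the index at level \<open>k \<le> m\<close> of the ancestor of node \<open>(m, j)\<close>.\<close>

definition ancestor :: "nat \<Rightarrow> nat \<Rightarrow> nat \<Rightarrow> nat" where
  "ancestor m j k = ((\<lambda>i. nat \<lceil>real i / 2\<rceil>) ^^ (m - k)) j"

definition branching_probabilities ::
  "'w measure \<Rightarrow> nat \<Rightarrow> real \<Rightarrow> (nat \<Rightarrow> real) \<Rightarrow> (nat \<Rightarrow> nat \<Rightarrow> 'w \<Rightarrow> real) \<Rightarrow> bool" where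
  "branching_probabilities P M \<alpha> \<rho> Y \<longleftrightarrow>
     prob_space.indep_vars P (\<lambda>_. borel) (\<lambda>(m, j). Y m (2 * j - 1))
       (SIGMA m:{1..M}. {1..2 ^ (m - 1)}) \<and>
     (\<forall>m\<in>{1..M}. \<forall>j\<in>{1..2 ^ (m - 1)}.
        distributed P lborel (Y m (2 * j - 1))
          (\<lambda>x. ennreal (beta_density (\<alpha> * \<rho> m) (\<alpha> * \<rho> m) x)) \<and>
        (\<forall>\<omega>\<in>space P. Y m (2 * j) \<omega> = 1 - Y m (2 * j - 1) \<omega>))"

text \<open>\<open>F\<close> is the random distribution, \<open>f\<close> its random density and \<open>Y\<close> the branching
  probabilities. The identity for \<open>F \<omega>\<close> is only required almost surely, since \<open>Y\<close> may leave the
  unit interval on a null set.\<close>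

definition finite_polya_tree ::
  "'w measure \<Rightarrow> nat \<Rightarrow> real \<Rightarrow> (nat \<Rightarrow> real) \<Rightarrow> real measure \<Rightarrow> (real \<Rightarrow> real) \<Rightarrow>
   (nat \<Rightarrow> nat \<Rightarrow> 'w \<Rightarrow> real) \<Rightarrow> ('w \<Rightarrow> real \<Rightarrow> real) \<Rightarrow> ('w \<Rightarrow> real measure) \<Rightarrow> bool" where
  "finite_polya_tree P M \<alpha> \<rho> F0 f0 Y f F \<longleftrightarrow>
     branching_probabilities P M \<alpha> \<rho> Y \<and>
     (\<forall>\<omega>\<in>space P. \<forall>x. f \<omega> x = (\<Prod>m=1..M. Y m (cell_index F0 m x) \<omega>) * 2 ^ M * f0 x) \<and>
     (AE \<omega> in P. F \<omega> = density lborel (\<lambda>x. ennreal (f \<omega> x)))"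

definition lambda2 :: "real \<Rightarrow> (nat \<Rightarrow> real) \<Rightarrow> nat \<Rightarrow> real" where
  "lambda2 \<alpha> \<rho> m = Digamma (\<alpha> * \<rho> m + 1) - Digamma (2 * \<alpha> * \<rho> m + 1)"

definition lambda3 :: "real \<Rightarrow> (nat \<Rightarrow> real) \<Rightarrow> nat \<Rightarrow> real" where
  "lambda3 \<alpha> \<rho> m = Digamma (\<alpha> * \<rho> m + 2) - Digamma (2 * \<alpha> * \<rho> m + 2)"

definition lambda4 :: "real \<Rightarrow> (nat \<Rightarrow> real) \<Rightarrow> nat \<Rightarrow> real" where
  "lambda4 \<alpha> \<rho> m = Digamma (\<alpha> * \<rho> m + 1) - Digamma (2 * \<alpha> * \<rho> m + 2)"

definition lambda5 :: "real \<Rightarrow> (nat \<Rightarrow> real) \<Rightarrow> nat \<Rightarrow> real" where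
  "lambda5 \<alpha> \<rho> m =
     Polygamma 1 (\<alpha> * \<rho> m + 2) - Polygamma 1 (2 * \<alpha> * \<rho> m + 2)
     + (Digamma (\<alpha> * \<rho> m + 2) - Digamma (2 * \<alpha> * \<rho> m + 2))\<^sup>2"

definition lambda6 :: "real \<Rightarrow> (nat \<Rightarrow> real) \<Rightarrow> nat \<Rightarrow> real" where
  "lambda6 \<alpha> \<rho> m =
     (Digamma (\<alpha> * \<rho> m + 1) - Digamma (2 * \<alpha> * \<rho> m + 2))\<^sup>2 - Polygamma 1 (2 * \<alpha> * \<rho> m + 2)"

definition var_A :: "nat \<Rightarrow> real \<Rightarrow> (nat \<Rightarrow> real) \<Rightarrow> real" where
  "var_A M \<alpha> \<rho> =
     (\<Sum>m=1..M. (\<Prod>k=1..m. (\<alpha> * \<rho> k + 1) / (2 * \<alpha> * \<rho> k + 1)) * lambda5 \<alpha> \<rho> m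
        - (1 / 2) ^ m * (lambda2 \<alpha> \<rho> m)\<^sup>2)"

definition var_B :: "nat \<Rightarrow> real \<Rightarrow> (nat \<Rightarrow> real) \<Rightarrow> real" where
  "var_B M \<alpha> \<rho> =
     (\<Sum>m=1..M.
        (\<alpha> * \<rho> m) / (2 * \<alpha> * \<rho> m + 1)
          * (\<Prod>k=1..m-1. (\<alpha> * \<rho> k + 1) / (2 * \<alpha> * \<rho> k + 1)) * lambda6 \<alpha> \<rho> m
        - (1 / 2) ^ m * (lambda2 \<alpha> \<rho> m)\<^sup>2
        + (\<Sum>j=1..m-1.
             (\<alpha> * \<rho> j) / (2 * \<alpha> * \<rho> j + 1)
               * (\<Prod>k=1..j-1. (\<alpha> * \<rho> k + 1) / (2 * \<alpha> * \<rho> k + 1)) * (lambda2 \<alpha> \<rho> m)\<^sup>2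
             - (1 / 2) ^ j * (lambda2 \<alpha> \<rho> m)\<^sup>2)
        + 2 * (\<Prod>k=1..m-1. (\<alpha> * \<rho> k + 1) / (2 * \<alpha> * \<rho> k + 1))
          * (\<Sum>j=m+1..M.
               (\<alpha> * \<rho> m + 1) / (2 * \<alpha> * \<rho> m + 1) * lambda3 \<alpha> \<rho> m * lambda2 \<alpha> \<rho> j
               + (\<alpha> * \<rho> m) / (2 * \<alpha> * \<rho> m + 1) * lambda4 \<alpha> \<rho> m * lambda2 \<alpha> \<rho> j
               - lambda2 \<alpha> \<rho> m * lambda2 \<alpha> \<rho> j))"

end

theory Submission
  imports Defs
begin

text \<open>The ratio \<open>f / f0\<close> is constant on each cell of level \<open>M\<close>, and each such cell has
  \<open>F0\<close>-probability \<open>2^-M\<close>. Hence the divergence is \<open>M ln 2\<close> plus the negative entropy of the cell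
  masses, which by the chain rule is a sum over the levels \<open>m\<close> of
  \<open>L\<^sub>m = \<Sum>\<^sub>i F(B\<^sub>m\<^sub>-\<^sub>1\<^sub>,\<^sub>i) h(X\<^sub>m\<^sub>,\<^sub>i)\<close> with \<open>h y = y ln y + (1 - y) ln (1 - y)\<close> and \<open>X\<^sub>m\<^sub>,\<^sub>i = Y\<^sub>m\<^sub>,\<^sub>2\<^sub>i\<^sub>-\<^sub>1\<close>. Since the
  splits of level \<open>m\<close> are independent of the earlier levels and the masses of a level sum to 1, the
  centred \<open>L\<^sub>m\<close> are martingale differences. They are therefore uncorrelated, and \<open>Var L\<^sub>m\<close> is
  \<open>Var (h X\<^sub>m\<^sub>,\<^sub>1)\<close> times the expected sum of squares of the masses of level \<open>m - 1\<close>, which is a product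
  over the levels. The moments of \<open>h\<close> under the beta distribution come from derivatives of the Beta
  function.\<close>

section \<open>Logarithmic moments of the beta distribution\<close>

text \<open>By convexity, \<open>exp (h * Z) \<ge> 1 + h * Z\<close>, so \<open>\<phi> h - h * \<integral> w Z\<close> is minimal at
  \<open>h = 0\<close>; this replaces differentiation under the integral sign.\<close>

lemma has_bochner_integral_exp_family_deriv:
  fixes w Z :: "'a \<Rightarrow> real"
  assumes [measurable]: "w \<in> borel_measurable N" "Z \<in> borel_measurable N"
    and w: "\<And>x. 0 \<le> w x" and e: "0 < e"
    and \<phi>: "\<And>h. \<bar>h\<bar> < e \<Longrightarrow> has_bochner_integral N (\<lambda>x. w x * exp (h * Z x)) (\<phi> h)"
    and D: "(\<phi> has_real_derivative D) (at 0)"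
  shows "has_bochner_integral N (\<lambda>x. w x * Z x) D"
proof -
  define d where "d = e / 2"
  have d: "0 < d" "d < e" using e by (auto simp: d_def)
  \<comment> \<open>Since \<open>d < e\<close>, both exponentials on the right are integrable
    against \<open>w\<close>, so this pointwise bound yields an integrable dominating function for
    \<open>w * Z\<close>.\<close>
  have "\<bar>z\<bar> \<le> (exp (d * z) + exp (- d * z)) / d" for z :: real
  proof -
    have "d * \<bar>z\<bar> \<le> exp (d * \<bar>z\<bar>)"
      using exp_ge_add_one_self[of "d * \<bar>z\<bar>"] by linarith
    also have "\<dots> \<le> exp (d * z) + exp (- d * z)"
      by (cases "z \<ge> 0") auto
    finally show ?thesis using d by (simp add: field_simps)
  qed
  then have *: "w x * \<bar>Z x\<bar> \<le> w x * ((exp (d * Z x) + exp (- d * Z x)) / d)" for x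
    by (intro mult_left_mono w)
  have bound: "norm (w x * Z x) \<le> norm ((w x * exp (d * Z x) + w x * exp (- d * Z x)) / d)" for x
  proof -
    have "norm (w x * Z x) = w x * \<bar>Z x\<bar>"
      using w[of x] by (simp add: abs_mult)
    also have "\<dots> \<le> (w x * exp (d * Z x) + w x * exp (- d * Z x)) / d"
      using *[of x] by (simp add: distrib_left)
    also have "\<dots> \<le> norm ((w x * exp (d * Z x) + w x * exp (- d * Z x)) / d)"
      unfolding real_norm_def by (rule abs_ge_self)
    finally show ?thesis .
  qed
  have "integrable N (\<lambda>x. (w x * exp (d * Z x) + w x * exp (- d * Z x)) / d)"
    using \<phi>[of d] \<phi>[of "- d"] d by (auto simp: has_bochner_integral_iff)
  then have int: "integrable N (\<lambda>x. w x * Z x)"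
    by (rule Bochner_Integration.integrable_bound) (measurable, rule AE_I2, rule bound)
  have int0: "integrable N w" "integral\<^sup>L N w = \<phi> 0"
    using \<phi>[of 0] e by (auto simp: has_bochner_integral_iff)
  define I where "I = integral\<^sup>L N (\<lambda>x. w x * Z x)"
  have "\<phi> 0 - 0 * I \<le> \<phi> h - h * I" if "\<bar>0 - h\<bar> < e" for h
  proof -
    have h: "has_bochner_integral N (\<lambda>x. w x * exp (h * Z x)) (\<phi> h)"
      using \<phi> that by simp
    have "w x * (1 + h * Z x) \<le> w x * exp (h * Z x)" for x
      by (intro mult_left_mono w exp_ge_add_one_self)
    then have le: "w x + h * (w x * Z x) \<le> w x * exp (h * Z x)" for x
      by (simp add: algebra_simps)
    have "\<phi> 0 + h * I = (\<integral>x. w x + h * (w x * Z x) \<partial>N)"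
      using int0 int by (simp add: I_def)
    also have "\<dots> \<le> \<phi> h"
      using h int0 int le by (subst has_bochner_integral_integral_eq[OF h, symmetric])
        (intro integral_mono, auto simp: has_bochner_integral_iff)
    finally show ?thesis by simp
  qed
  moreover have "((\<lambda>h. \<phi> h - h * I) has_real_derivative D - I) (at 0)"
    by (auto intro!: derivative_eq_intros D)
  ultimately have "D - I = 0"
    using e by (intro DERIV_local_min[of "\<lambda>h. \<phi> h - h * I" "D - I" 0 e]) auto
  then show ?thesis
    using int by (simp add: has_bochner_integral_iff I_def)
qed

text \<open>The beta density without its normalising constant: multiplication by powers of x or 1 -
  x merely shifts \<open>p\<close> or \<open>q\<close>, so moments become values of
  \<open>Beta\<close>.\<close>

definition beta_kernel :: "real \<Rightarrow> real \<Rightarrow> real \<Rightarrow> real" where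
  "beta_kernel p q x = indicator {0<..<1} x * (x powr (p - 1) * (1 - x) powr (q - 1))"

lemma beta_kernel_measurable [measurable]: "beta_kernel p q \<in> borel_measurable borel"
  unfolding beta_kernel_def by measurable

lemma beta_kernel_nonneg: "0 \<le> beta_kernel p q x"
  by (simp add: beta_kernel_def)

lemma beta_kernel_reflect: "beta_kernel p q (1 - x) = beta_kernel q p x"
  by (auto simp: beta_kernel_def indicator_def)

lemma beta_kernel_plus:
  "beta_kernel (p + 1) q x = x * beta_kernel p q x"
  "beta_kernel p (q + 1) x = (1 - x) * beta_kernel p q x"
  by (auto simp: beta_kernel_def indicator_def powr_diff)

lemma beta_kernel_plus2:
  "beta_kernel (p + 2) q x = x\<^sup>2 * beta_kernel p q x"
  "beta_kernel p (q + 2) x = (1 - x)\<^sup>2 * beta_kernel p q x"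
  using beta_kernel_plus(1)[of "p + 1" q x] beta_kernel_plus(2)[of p "q + 1" x]
  by (simp_all add: beta_kernel_plus power2_eq_square add.assoc mult.assoc)

text \<open>Exponential tilting by a logarithm stays within the family of kernels. The function
  \<open>\<phi>\<close> of the exponential-family lemma is therefore \<open>Beta\<close> with one
  shifted argument.\<close>

lemma beta_kernel_exp_ln:
  "beta_kernel p q x * exp (h * ln x) = beta_kernel (p + h) q x"
  "beta_kernel p q x * exp (h * ln (1 - x)) = beta_kernel p (q + h) x"
  by (auto simp: beta_kernel_def indicator_def powr_def exp_add[symmetric] algebra_simps)

lemma has_bochner_integral_beta_kernel:
  assumes "0 < p" "0 < q"
  shows "has_bochner_integral lborel (beta_kernel p q) (Beta p q)"
proof -
  have "set_integrable lborel {0..1} (\<lambda>t. t powr (p - 1) * (1 - t) powr (q - 1))"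
    using integrable_Beta[OF assms] .
  then have int: "set_integrable lborel {0<..<1} (\<lambda>t. t powr (p - 1) * (1 - t) powr (q - 1))"
    by (rule set_integrable_subset) auto
  have "((\<lambda>t. t powr (p - 1) * (1 - t) powr (q - 1)) has_integral Beta p q) {0<..<1}"
    using has_integral_Beta_real[OF assms] by (simp add: has_integral_Icc_iff_Ioo)
  then have "(LINT t:{0<..<1}|lborel. t powr (p - 1) * (1 - t) powr (q - 1)) = Beta p q"
    using set_borel_integral_eq_integral(2)[OF int] integral_unique by metis
  then show ?thesis
    using int by (simp add: has_bochner_integral_iff set_integrable_def
      set_lebesgue_integral_def beta_kernel_def[abs_def])
qed

text \<open>Lebesgue measure is invariant under the reflection that swaps x and 1 - x. For a
  symmetric beta law this yields the terms in 1 - x from those in x.\<close>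

lemma has_bochner_integral_reflect:
  fixes g :: "real \<Rightarrow> real"
  assumes "has_bochner_integral lborel g I"
  shows "has_bochner_integral lborel (\<lambda>x. g (1 - x)) I"
  using assms lborel_integrable_real_affine_iff[of "-1" g 1] lborel_integral_real_affine[of "-1" g 1]
  by (simp add: has_bochner_integral_iff)

lemma has_bochner_integral_beta_ln:
  assumes p: "0 < p" and q: "0 < q"
  shows "has_bochner_integral lborel (\<lambda>x. beta_kernel p q x * ln x)
    (Beta p q * (Digamma p - Digamma (p + q)))"
proof (rule has_bochner_integral_exp_family_deriv[where e = p and \<phi> = "\<lambda>h. Beta (p + h) q"])
  show "has_bochner_integral lborel (\<lambda>x. beta_kernel p q x * exp (h * ln x)) (Beta (p + h) q)"
    if "\<bar>h\<bar> < p" for h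
    unfolding beta_kernel_exp_ln using that q by (intro has_bochner_integral_beta_kernel) auto
  have "((\<lambda>u. Beta u q) has_real_derivative Beta p q * (Digamma p - Digamma (p + q))) (at (0 + p))"
    using p q by (auto intro!: derivative_eq_intros simp: nonpos_Ints_def)
  then show "((\<lambda>h. Beta (p + h) q) has_real_derivative Beta p q * (Digamma p - Digamma (p + q))) (at 0)"
    unfolding DERIV_shift by (simp add: add.commute)
qed (use p in \<open>auto simp: beta_kernel_nonneg\<close>)

text \<open>The first logarithm is absorbed into the weight \<open>w\<close>, which makes the second-order moments
  first derivatives again.\<close>

lemma beta_kernel_ln_nonneg: "0 \<le> beta_kernel p q x * - ln x"
  by (auto simp: beta_kernel_def indicator_def mult_nonneg_nonpos)

lemma has_bochner_integral_beta_ln_sq: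
  assumes p: "0 < p" and q: "0 < q"
  shows "has_bochner_integral lborel (\<lambda>x. beta_kernel p q x * (ln x)\<^sup>2)
    (Beta p q * (Polygamma 1 p - Polygamma 1 (p + q) + (Digamma p - Digamma (p + q))\<^sup>2))"
    (is "has_bochner_integral _ _ ?D")
proof -
  let ?\<phi> = "\<lambda>u. - (Beta u q * (Digamma u - Digamma (u + q)))"
  \<comment> \<open>\<open>ln\<close> is negative on the unit interval, so the minus sign makes the
    weight nonnegative; it is undone at the end.\<close>
  have "has_bochner_integral lborel (\<lambda>x. (beta_kernel p q x * - ln x) * ln x) (- ?D)"
  proof (rule has_bochner_integral_exp_family_deriv[where e = p and \<phi> = "\<lambda>h. ?\<phi> (p + h)"])
    show "has_bochner_integral lborel (\<lambda>x. (beta_kernel p q x * - ln x) * exp (h * ln x)) (?\<phi> (p + h))"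
      if "\<bar>h\<bar> < p" for h
    proof -
      have "(\<lambda>x. (beta_kernel p q x * - ln x) * exp (h * ln x))
          = (\<lambda>x. - (beta_kernel (p + h) q x * ln x))"
        by (simp flip: beta_kernel_exp_ln add: mult.assoc mult.commute[of "ln _" "exp _"])
      then show ?thesis
        using that q by (auto intro!: has_bochner_integral_minus has_bochner_integral_beta_ln
            simp del: minus_mult_right)
    qed
    have "(?\<phi> has_real_derivative - ?D) (at (0 + p))"
      using p q by (auto intro!: derivative_eq_intros simp: nonpos_Ints_def algebra_simps power2_eq_square)
    then show "((\<lambda>h. ?\<phi> (p + h)) has_real_derivative - ?D) (at 0)"
      unfolding DERIV_shift by (simp add: add.commute)
  qed (use p beta_kernel_ln_nonneg in auto)
  from has_bochner_integral_minus[OF this] show ?thesis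
    by (simp add: power2_eq_square ac_simps)
qed

lemma has_bochner_integral_beta_ln_ln:
  assumes p: "0 < p" and q: "0 < q"
  shows "has_bochner_integral lborel (\<lambda>x. beta_kernel p q x * (ln x * ln (1 - x)))
    (Beta p q * ((Digamma p - Digamma (p + q)) * (Digamma q - Digamma (p + q)) - Polygamma 1 (p + q)))"
    (is "has_bochner_integral _ _ ?D")
proof -
  \<comment> \<open>The \<open>ln x\<close> moment is now differentiated in the other parameter.
    \<open>Digamma p\<close> is constant there, hence only the trigamma value at
    \<open>p + q\<close> survives.\<close>
  let ?\<phi> = "\<lambda>u. - (Beta p u * (Digamma p - Digamma (p + u)))"
  have "has_bochner_integral lborel (\<lambda>x. (beta_kernel p q x * - ln x) * ln (1 - x)) (- ?D)"
  proof (rule has_bochner_integral_exp_family_deriv[where e = q and \<phi> = "\<lambda>h. ?\<phi> (q + h)"])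
    show "has_bochner_integral lborel (\<lambda>x. (beta_kernel p q x * - ln x) * exp (h * ln (1 - x))) (?\<phi> (q + h))"
      if "\<bar>h\<bar> < q" for h
    proof -
      have "(\<lambda>x. (beta_kernel p q x * - ln x) * exp (h * ln (1 - x)))
          = (\<lambda>x. - (beta_kernel p (q + h) x * ln x))"
        by (simp flip: beta_kernel_exp_ln add: mult.assoc mult.commute[of "ln _" "exp _"])
      then show ?thesis
        using that p by (auto intro!: has_bochner_integral_minus has_bochner_integral_beta_ln
            simp del: minus_mult_right)
    qed
    have "(?\<phi> has_real_derivative - ?D) (at (0 + q))"
      using p q by (auto intro!: derivative_eq_intros simp: nonpos_Ints_def algebra_simps power2_eq_square)
    then show "((\<lambda>h. ?\<phi> (q + h)) has_real_derivative - ?D) (at 0)"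
      unfolding DERIV_shift by (simp add: add.commute)
  qed (use q beta_kernel_ln_nonneg in auto)
  from has_bochner_integral_minus[OF this] show ?thesis
    by (simp add: ac_simps)
qed

section \<open>Entropy moments of a symmetric beta variable\<close>

definition neg_entropy :: "real \<Rightarrow> real" where
  "neg_entropy y = y * ln y + (1 - y) * ln (1 - y)"

lemma neg_entropy_measurable [measurable]: "neg_entropy \<in> borel_measurable borel"
  unfolding neg_entropy_def by measurable

text \<open>The inequality ln t \<le> t - 1 at t = 1/y places y ln y between -(1 - y) and 0; the
  lower bounds for y and 1 - y add up to -1. The sharp constant would be ln 2, but 1 makes products
  of bounds trivial.\<close>

lemma neg_entropy_bound:
  assumes "0 < y" "y < 1"
  shows "\<bar>neg_entropy y\<bar> \<le> 1"
proof -
  have *: "- (1 - y) \<le> y * ln y \<and> y * ln y \<le> 0" if "0 < y" "y < 1" for y :: real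
  proof -
    have "- ln y \<le> 1 / y - 1"
      using ln_le_minus_one[of "1 / y"] that by (simp add: ln_div)
    then have "y * - ln y \<le> y * (1 / y - 1)" using that by (intro mult_left_mono) auto
    then show ?thesis using that by (auto simp: algebra_simps mult_nonneg_nonpos)
  qed
  show ?thesis
    using *[of y] *[of "1 - y"] assms by (auto simp: neg_entropy_def abs_le_iff)
qed

lemma has_bochner_integral_beta_distributed:
  assumes X: "distributed P lborel X (\<lambda>x. ennreal (beta_density a b x))"
    and pos: "0 < a" "0 < b"
    and [measurable]: "g \<in> borel_measurable borel"
    and I: "has_bochner_integral lborel (\<lambda>x. beta_kernel a b x * g x) I"
  shows "has_bochner_integral P (\<lambda>\<omega>. g (X \<omega>)) (I / Beta a b)"
proof -
  have B: "Beta a b > 0"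
    using pos by (auto simp: Beta_def intro!: divide_pos_pos mult_pos_pos Gamma_real_pos)
  have dens: "beta_density a b x = beta_kernel a b x / Beta a b" for x
    by (auto simp: beta_density_def beta_kernel_def indicator_def)
  have nonneg: "0 \<le> beta_density a b x" for x
    using B by (simp add: dens beta_kernel_nonneg)
  have "has_bochner_integral lborel (\<lambda>x. beta_density a b x * g x) (I / Beta a b)"
    using has_bochner_integral_divide_zero[OF I, of "Beta a b"] by (simp add: dens)
  then show ?thesis
    using distributed_integrable[OF X, of g] distributed_integral[OF X, of g] nonneg
    by (auto simp: has_bochner_integral_iff)
qed

lemma beta_distributed_AE:
  assumes X: "distributed P lborel X (\<lambda>x. ennreal (beta_density a b x))"
  shows "AE \<omega> in P. 0 < X \<omega> \<and> X \<omega> < 1"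
proof -
  have X': "X \<in> measurable P lborel" "distr P lborel X = density lborel (\<lambda>x. ennreal (beta_density a b x))"
    "(\<lambda>x. ennreal (beta_density a b x)) \<in> borel_measurable lborel"
    using X by (auto simp: distributed_def)
  have "AE x in distr P lborel X. 0 < x \<and> x < 1"
    unfolding X'(2) by (subst AE_density[OF X'(3)]) (auto simp: beta_density_def)
  with X'(1) show ?thesis by (rule AE_distrD)
qed

context
  fixes P :: "'w measure" and X :: "'w \<Rightarrow> real" and a :: real
  assumes X: "distributed P lborel X (\<lambda>x. ennreal (beta_density a a x))" and a: "0 < a"
begin

text \<open>These are twice the means of X, of X squared and of X (1 - X). The doubling accounts for
  the two symmetric halves and for the cross term of a square; the last two values sum to 1.\<close>

lemma Beta_ratio:
  "2 * (Beta (a + 1) a / Beta a a) = 1"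
  "2 * (Beta (a + 2) a / Beta a a) = (a + 1) / (2 * a + 1)"
  "2 * (Beta (a + 1) (a + 1) / Beta a a) = a / (2 * a + 1)"
proof -
  have B: "Beta a a > 0"
    using a by (auto simp: Beta_def intro!: divide_pos_pos mult_pos_pos Gamma_real_pos)
  have 1: "Beta (a + 1) a = Beta a a / 2"
    using Beta_plus1_left[of a a] a by (simp add: nonpos_Ints_def field_simps)
  have 2: "(2 * a + 1) * Beta (a + 2) a = (a + 1) * Beta (a + 1) a"
    using Beta_plus1_left[of "a + 1" a] a by (simp add: nonpos_Ints_def algebra_simps)
  have 3: "(2 * a + 1) * Beta (a + 1) (a + 1) = a * Beta (a + 1) a"
    using Beta_plus1_right[of a "a + 1"] a by (simp add: nonpos_Ints_def algebra_simps)
  show "2 * (Beta (a + 1) a / Beta a a) = 1" using 1 B by simp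
  show "2 * (Beta (a + 2) a / Beta a a) = (a + 1) / (2 * a + 1)"
    using 2 B a unfolding 1 by (simp add: field_simps)
  show "2 * (Beta (a + 1) (a + 1) / Beta a a) = a / (2 * a + 1)"
    using 3 B a unfolding 1 by (simp add: field_simps)
qed

lemma has_bochner_integral_neg_entropy_beta:
  "has_bochner_integral P (\<lambda>\<omega>. neg_entropy (X \<omega>)) (Digamma (a + 1) - Digamma (2 * a + 1))"
proof -
  let ?I = "Beta (a + 1) a * (Digamma (a + 1) - Digamma (a + 1 + a))"
  have 1: "has_bochner_integral lborel (\<lambda>x. beta_kernel (a + 1) a x * ln x) ?I"
    using a by (intro has_bochner_integral_beta_ln) auto
  \<comment> \<open>The factor x of x ln x raises the first parameter to \<open>a + 1\<close>;
    reflection supplies the other half of the entropy.\<close>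
  have "has_bochner_integral lborel
      (\<lambda>x. beta_kernel (a + 1) a x * ln x + beta_kernel (a + 1) a (1 - x) * ln (1 - x)) (?I + ?I)"
    by (intro has_bochner_integral_add 1 has_bochner_integral_reflect[OF 1])
  also have "(\<lambda>x. beta_kernel (a + 1) a x * ln x + beta_kernel (a + 1) a (1 - x) * ln (1 - x))
      = (\<lambda>x. beta_kernel a a x * neg_entropy x)"
    unfolding beta_kernel_reflect beta_kernel_plus neg_entropy_def by (simp add: fun_eq_iff algebra_simps)
  finally have "has_bochner_integral P (\<lambda>\<omega>. neg_entropy (X \<omega>)) ((?I + ?I) / Beta a a)"
    by (intro has_bochner_integral_beta_distributed[OF X a a]) auto
  also have "(?I + ?I) / Beta a a
      = 2 * (Beta (a + 1) a / Beta a a) * (Digamma (a + 1) - Digamma (2 * a + 1))"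
    by (simp add: add_divide_distrib ac_simps flip: mult_2)
  finally show ?thesis unfolding Beta_ratio by simp
qed

text \<open>In the expanded square the two pure squares are reflections of each other and give the
  term of \<open>lambda5\<close>; the doubled cross term gives that of
  \<open>lambda6\<close>.\<close>

lemma has_bochner_integral_neg_entropy_sq_beta:
  "has_bochner_integral P (\<lambda>\<omega>. (neg_entropy (X \<omega>))\<^sup>2)
    ((a + 1) / (2 * a + 1) * (Polygamma 1 (a + 2) - Polygamma 1 (2 * a + 2)
        + (Digamma (a + 2) - Digamma (2 * a + 2))\<^sup>2)
     + a / (2 * a + 1) * ((Digamma (a + 1) - Digamma (2 * a + 2))\<^sup>2 - Polygamma 1 (2 * a + 2)))"
    (is "has_bochner_integral _ _ (_ * ?l5 + _ * ?l6)")
proof -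
  let ?I = "Beta (a + 2) a * ?l5" and ?J = "Beta (a + 1) (a + 1) * ?l6"
  have 1: "has_bochner_integral lborel (\<lambda>x. beta_kernel (a + 2) a x * (ln x)\<^sup>2) ?I"
    using has_bochner_integral_beta_ln_sq[of "a + 2" a] a by (simp add: algebra_simps)
  have 2: "has_bochner_integral lborel (\<lambda>x. beta_kernel (a + 1) (a + 1) x * (ln x * ln (1 - x))) ?J"
    using has_bochner_integral_beta_ln_ln[of "a + 1" "a + 1"] a
    by (simp add: algebra_simps power2_eq_square)
  have "has_bochner_integral lborel
      (\<lambda>x. (beta_kernel (a + 2) a x * (ln x)\<^sup>2 + beta_kernel (a + 2) a (1 - x) * (ln (1 - x))\<^sup>2)
        + 2 * (beta_kernel (a + 1) (a + 1) x * (ln x * ln (1 - x)))) ((?I + ?I) + 2 * ?J)"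
    by (intro has_bochner_integral_add has_bochner_integral_mult_right 1 2 has_bochner_integral_reflect[OF 1])
  also have "(\<lambda>x. (beta_kernel (a + 2) a x * (ln x)\<^sup>2 + beta_kernel (a + 2) a (1 - x) * (ln (1 - x))\<^sup>2)
        + 2 * (beta_kernel (a + 1) (a + 1) x * (ln x * ln (1 - x))))
      = (\<lambda>x. beta_kernel a a x * (neg_entropy x)\<^sup>2)"
    unfolding beta_kernel_reflect beta_kernel_plus2 beta_kernel_plus neg_entropy_def
    by (simp add: fun_eq_iff algebra_simps power2_eq_square)
  finally have "has_bochner_integral P (\<lambda>\<omega>. (neg_entropy (X \<omega>))\<^sup>2) (((?I + ?I) + 2 * ?J) / Beta a a)"
    by (intro has_bochner_integral_beta_distributed[OF X a a]) auto
  also have "((?I + ?I) + 2 * ?J) / Beta a a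
      = 2 * (Beta (a + 2) a / Beta a a) * ?l5 + 2 * (Beta (a + 1) (a + 1) / Beta a a) * ?l6"
    by (simp add: add_divide_distrib)
  finally show ?thesis unfolding Beta_ratio by simp
qed

text \<open>This is the mean factor by which one split changes a squared mass, summed over both
  children.\<close>

lemma has_bochner_integral_sum_squares_beta:
  "has_bochner_integral P (\<lambda>\<omega>. (X \<omega>)\<^sup>2 + (1 - X \<omega>)\<^sup>2) ((a + 1) / (2 * a + 1))"
proof -
  have 1: "has_bochner_integral lborel (beta_kernel (a + 2) a) (Beta (a + 2) a)"
    using a by (intro has_bochner_integral_beta_kernel) auto
  have "has_bochner_integral lborel
      (\<lambda>x. beta_kernel (a + 2) a x + beta_kernel (a + 2) a (1 - x)) (Beta (a + 2) a + Beta (a + 2) a)"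
    by (intro has_bochner_integral_add 1 has_bochner_integral_reflect[OF 1])
  also have "(\<lambda>x. beta_kernel (a + 2) a x + beta_kernel (a + 2) a (1 - x))
      = (\<lambda>x. beta_kernel a a x * (x\<^sup>2 + (1 - x)\<^sup>2))"
    by (simp add: beta_kernel_reflect beta_kernel_plus2 fun_eq_iff distrib_left mult.commute)
  finally have "has_bochner_integral P (\<lambda>\<omega>. (X \<omega>)\<^sup>2 + (1 - X \<omega>)\<^sup>2)
      ((Beta (a + 2) a + Beta (a + 2) a) / Beta a a)"
    by (intro has_bochner_integral_beta_distributed[OF X a a]) auto
  also have "(Beta (a + 2) a + Beta (a + 2) a) / Beta a a = 2 * (Beta (a + 2) a / Beta a a)"
    by simp
  finally show ?thesis unfolding Beta_ratio by simp
qed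

end

section \<open>Masses and entropies on a binary tree\<close>

text \<open>An integer form of the ceiling of j/2 that occurs in \<open>ancestor\<close>;
  \<open>ceiling_half\<close> connects the two.\<close>

definition parent :: "nat \<Rightarrow> nat" where
  "parent j = (j + 1) div 2"

text \<open>A tree is encoded by its independent splits alone: coordinate \<open>(m, i)\<close> is
  the share that node \<open>i\<close> of level \<open>m - 1\<close> passes to its odd child, and
  the even child receives the complement.\<close>

definition branch :: "(nat \<times> nat \<Rightarrow> real) \<Rightarrow> nat \<Rightarrow> nat \<Rightarrow> real" where
  "branch x m j = (if odd j then x (m, parent j) else 1 - x (m, parent j))"

primrec mass :: "(nat \<times> nat \<Rightarrow> real) \<Rightarrow> nat \<Rightarrow> nat \<Rightarrow> real" where
  "mass x 0 j = 1"
| "mass x (Suc m) j = mass x m (parent j) * branch x (Suc m) j"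

text \<open>The contribution of level \<open>n + 1\<close>, grouped by the parents at level \<open>n\<close>.\<close>

definition level_entropy :: "(nat \<times> nat \<Rightarrow> real) \<Rightarrow> nat \<Rightarrow> real" where
  "level_entropy x n = (\<Sum>i=1..2 ^ n. mass x n i * neg_entropy (x (Suc n, i)))"

text \<open>These coordinates decide all masses up to level \<open>n\<close>. The sets increase with
  \<open>n\<close> and play the role of the filtration in the martingale argument.\<close>

definition nodes :: "nat \<Rightarrow> (nat \<times> nat) set" where
  "nodes n = (SIGMA m:{1..n}. {1..2 ^ (m - 1)})"

lemma parent_simps [simp]: "parent (2 * i) = i" "Suc 0 \<le> i \<Longrightarrow> parent (2 * i - Suc 0) = i"
  by (auto simp: parent_def)

lemma parent_in: "j \<in> {1..2 ^ Suc m} \<Longrightarrow> parent j \<in> {1..2 ^ m}"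
  by (auto simp: parent_def)

lemma sum_pairs:
  fixes f :: "nat \<Rightarrow> 'a::comm_monoid_add"
  shows "(\<Sum>j=1..2 * n. f j) = (\<Sum>i=1..n. f (2 * i - 1) + f (2 * i))"
  by (induction n) (auto simp: add.assoc)

lemma sum_children:
  fixes f :: "nat \<Rightarrow> 'a::comm_monoid_add"
  shows "(\<Sum>j=1..2 ^ Suc m. f j) = (\<Sum>i=1..2 ^ m. f (2 * i - 1) + f (2 * i))"
  using sum_pairs[of f "2 ^ m"] by simp

lemma branch_children [simp]:
  "Suc 0 \<le> i \<Longrightarrow> branch x m (2 * i - Suc 0) = x (m, i)" "branch x m (2 * i) = 1 - x (m, i)"
  by (auto simp: branch_def)

text \<open>The children are grouped by their parent. Taking for \<open>g\<close> the constant 1,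
  the logarithm of the branch or that of the parent's mass gives the three sums needed
  below.\<close>

lemma sum_mass_Suc:
  "(\<Sum>j=1..2 ^ Suc m. mass x m (parent j) * branch x (Suc m) j * g j)
    = (\<Sum>i=1..2 ^ m. mass x m i * (x (Suc m, i) * g (2 * i - 1) + (1 - x (Suc m, i)) * g (2 * i)))"
  unfolding sum_children by (intro sum.cong refl) (clarsimp, simp add: algebra_simps)

lemma sum_mass: "(\<Sum>j=1..2 ^ m. mass x m j) = 1"
proof (induction m)
  case (Suc m)
  then show ?case using sum_mass_Suc[where g = "\<lambda>_. 1" and m = m and x = x] by simp
qed simp

text \<open>This identifies one level of the double sum in the theorem, shifted by one, with the
  entropy grouped by parents.\<close>

lemma level_entropy_eq:
  "(\<Sum>j=1..2 ^ Suc n. ln (branch x (Suc n) j) * mass x (Suc n) j) = level_entropy x n"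
proof -
  have "(\<Sum>j=1..2 ^ Suc n. ln (branch x (Suc n) j) * mass x (Suc n) j)
      = (\<Sum>j=1..2 ^ Suc n. mass x n (parent j) * branch x (Suc n) j * ln (branch x (Suc n) j))"
    by (simp add: mult.commute)
  also have "\<dots> = level_entropy x n"
    unfolding sum_mass_Suc level_entropy_def neg_entropy_def by (intro sum.cong refl) simp
  finally show ?thesis .
qed

context
  fixes x :: "nat \<times> nat \<Rightarrow> real"
  assumes x: "\<And>k. 0 < x k \<and> x k < 1"
begin

lemma branch_pos: "0 < branch x m j"
  using x by (simp add: branch_def)

lemma mass_pos: "0 < mass x m j"
  by (induction m arbitrary: j) (auto simp: branch_pos)

lemma mass_le_1: "mass x m j \<le> 1"
proof (induction m arbitrary: j)
  case (Suc m)
  have "branch x (Suc m) j \<le> 1" using x by (auto simp: branch_def intro: less_imp_le)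
  then show ?case
    using Suc[of "parent j"] mass_pos[of m "parent j"] branch_pos[of "Suc m" j] by (simp add: mult_le_one)
qed simp

lemma abs_level_entropy: "\<bar>level_entropy x n\<bar> \<le> 1"
proof -
  have "\<bar>level_entropy x n\<bar> \<le> (\<Sum>i=1..2 ^ n. mass x n i)"
    unfolding level_entropy_def
  proof (rule order_trans[OF sum_abs sum_mono])
    fix i
    show "\<bar>mass x n i * neg_entropy (x (Suc n, i))\<bar> \<le> mass x n i"
      using neg_entropy_bound[of "x (Suc n, i)"] x mass_pos[of n i]
      by (simp add: abs_mult mult_left_le)
  qed
  then show ?thesis by (simp add: sum_mass[simplified])
qed

text \<open>The chain rule of entropy: the logarithm of a mass is that of the parent's mass plus
  that of the branch. The first part recombines over siblings into the sum of the previous level,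
  the second is the new level entropy.\<close>

lemma sum_mass_ln_mass:
  "(\<Sum>j=1..2 ^ n. mass x n j * ln (mass x n j)) = (\<Sum>m<n. level_entropy x m)"
proof (induction n)
  case (Suc n)
  have "(\<Sum>j=1..2 ^ Suc n. mass x (Suc n) j * ln (mass x (Suc n) j))
      = (\<Sum>j=1..2 ^ Suc n. mass x n (parent j) * branch x (Suc n) j * ln (mass x n (parent j)))
        + (\<Sum>j=1..2 ^ Suc n. ln (branch x (Suc n) j) * mass x (Suc n) j)"
    unfolding sum.distrib[symmetric]
    by (intro sum.cong refl) (simp add: ln_mult mass_pos branch_pos algebra_simps)
  also have "(\<Sum>j=1..2 ^ Suc n. mass x n (parent j) * branch x (Suc n) j * ln (mass x n (parent j)))
      = (\<Sum>j=1..2 ^ n. mass x n j * ln (mass x n j))"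
    unfolding sum_mass_Suc by (intro sum.cong refl) (clarsimp, simp add: algebra_simps)
  finally show ?case
    unfolding level_entropy_eq Suc.IH by simp
qed simp

end

section \<open>Functionals of a set of splits and their independence\<close>

definition determined_by :: "((nat \<times> nat \<Rightarrow> real) \<Rightarrow> real) \<Rightarrow> (nat \<times> nat) set \<Rightarrow> bool" where
  "determined_by U K \<longleftrightarrow> U \<in> borel_measurable (PiM K (\<lambda>_. borel)) \<and> (\<forall>x. U (restrict x K) = U x)"

lemma determined_byD:
  assumes "determined_by U K"
  shows "U \<in> borel_measurable (PiM K (\<lambda>_. borel))" "U (restrict x K) = U x"
  using assms unfolding determined_by_def by blast+

lemma determined_by_mono:
  assumes U: "determined_by U K" and K: "K \<subseteq> K'"
  shows "determined_by U K'"
proof -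
  note meas = determined_byD(1)[OF U] and U_eq = determined_byD(2)[OF U]
  have "(\<lambda>x. U (restrict x K)) \<in> borel_measurable (PiM K' (\<lambda>_. borel))"
    by (rule measurable_compose[OF measurable_restrict_subset[OF K] meas])
  moreover have "U (restrict x K') = U x" for x
  proof -
    have "U (restrict x K') = U (restrict (restrict x K') K)"
      by (rule U_eq[symmetric])
    also have "\<dots> = U (restrict x K)"
      using K by (simp add: Int_absorb1)
    finally show ?thesis by (simp only: U_eq)
  qed
  ultimately show ?thesis by (simp add: determined_by_def U_eq)
qed

lemma determined_by_component:
  "k \<in> K \<Longrightarrow> g \<in> borel_measurable borel \<Longrightarrow> determined_by (\<lambda>x. g (x k)) K"
  using measurable_compose[OF measurable_component_singleton[of k K "\<lambda>_. borel :: real measure"]]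
  by (auto simp: determined_by_def)

lemma determined_by_const: "determined_by (\<lambda>x. c) K"
  by (simp add: determined_by_def)

lemma determined_by_mult:
  "determined_by U K \<Longrightarrow> determined_by V K \<Longrightarrow> determined_by (\<lambda>x. U x * V x) K"
  by (auto simp: determined_by_def)

lemma determined_by_sum:
  "(\<And>i. i \<in> A \<Longrightarrow> determined_by (U i) K) \<Longrightarrow> determined_by (\<lambda>x. \<Sum>i\<in>A. U i x) K"
  by (auto simp: determined_by_def intro!: borel_measurable_sum sum.cong)

lemma determined_by_measurable:
  assumes U: "determined_by U K" and X: "\<And>k. k \<in> K \<Longrightarrow> (\<lambda>\<omega>. X \<omega> k) \<in> borel_measurable N"
  shows "(\<lambda>\<omega>. U (X \<omega>)) \<in> borel_measurable N"
proof -
  have "(\<lambda>\<omega>. restrict (X \<omega>) K) \<in> measurable N (PiM K (\<lambda>_. borel))"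
    using X by (intro measurable_restrict)
  then have "(\<lambda>\<omega>. U (restrict (X \<omega>) K)) \<in> borel_measurable N"
    using determined_byD(1)[OF U] by (rule measurable_compose)
  then show ?thesis
    by (simp only: determined_byD(2)[OF U])
qed

lemma determined_by_cong:
  assumes U: "determined_by U K" and "\<And>k. k \<in> K \<Longrightarrow> x k = y k"
  shows "U x = U y"
proof -
  have "restrict x K = restrict y K" using assms(2) by (rule restrict_ext)
  then show ?thesis using determined_byD(2)[OF U] by metis
qed

lemma nodes_mono: "m \<le> n \<Longrightarrow> nodes m \<subseteq> nodes n"
  by (auto simp: nodes_def)

lemma Suc_nodes_iff: "(Suc n, i) \<in> nodes m \<longleftrightarrow> n < m \<and> i \<in> {1..2 ^ n}"
  by (auto simp: nodes_def)

lemma determined_by_mass: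
  "j \<in> {1..2 ^ n} \<Longrightarrow> determined_by (\<lambda>x. mass x n j) (nodes n)"
proof (induction n arbitrary: j)
  case (Suc n)
  have "(Suc n, parent j) \<in> nodes (Suc n)"
    using parent_in[OF Suc.prems] by (simp add: Suc_nodes_iff)
  then have "determined_by (\<lambda>x. branch x (Suc n) j) (nodes (Suc n))"
    unfolding branch_def by (cases "odd j")
      (auto intro: determined_by_component[where g = "\<lambda>y. y"] determined_by_component[where g = "\<lambda>y. 1 - y"])
  moreover have "determined_by (\<lambda>x. mass x n (parent j)) (nodes (Suc n))"
    using Suc.IH[OF parent_in[OF Suc.prems]] by (rule determined_by_mono) (simp add: nodes_mono)
  ultimately show ?case by (simp add: determined_by_mult)
qed (simp add: determined_by_const)

lemma determined_by_level_entropy: "determined_by (\<lambda>x. level_entropy x n) (nodes (Suc n))"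
  unfolding level_entropy_def
  by (intro determined_by_sum determined_by_mult determined_by_mono[OF determined_by_mass]
      determined_by_component) (auto simp: Suc_nodes_iff nodes_mono)

text \<open>Restrictions of an independent family to the disjoint index sets \<open>K\<close> and
  \<open>{k}\<close> are independent. The equation in \<open>determined_by\<close> lets
  \<open>U\<close> factor through the first restriction.\<close>

lemma (in prob_space) expectation_mult_determined:
  fixes X :: "'a \<Rightarrow> nat \<times> nat \<Rightarrow> real"
  assumes ind: "indep_vars (\<lambda>_. borel) (\<lambda>k \<omega>. X \<omega> k) I" and K: "K \<subseteq> I" "k \<in> I - K"
    and U: "determined_by U K" and g: "g \<in> borel_measurable borel"
    and int: "integrable M (\<lambda>\<omega>. U (X \<omega>))" "integrable M (\<lambda>\<omega>. g (X \<omega> k))"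
  shows "expectation (\<lambda>\<omega>. U (X \<omega>) * g (X \<omega> k)) = expectation (\<lambda>\<omega>. U (X \<omega>)) * expectation (\<lambda>\<omega>. g (X \<omega> k))"
proof -
  have "indep_var (PiM K (\<lambda>_. borel)) (\<lambda>\<omega>. restrict (X \<omega>) K) (PiM {k} (\<lambda>_. borel)) (\<lambda>\<omega>. restrict (X \<omega>) {k})"
    using indep_var_restrict[OF ind, of K "{k}"] K by auto
  then have "indep_var borel (U \<circ> (\<lambda>\<omega>. restrict (X \<omega>) K)) borel ((\<lambda>x. g (x k)) \<circ> (\<lambda>\<omega>. restrict (X \<omega>) {k}))"
    using determined_byD(1)[OF U] determined_byD(1)[OF determined_by_component[of k "{k}" g]] g
    by (intro indep_var_compose) auto
  then have "indep_var borel (\<lambda>\<omega>. U (X \<omega>)) borel (\<lambda>\<omega>. g (X \<omega> k))"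
    by (simp add: determined_byD(2)[OF U] comp_def)
  then show ?thesis using int by (rule indep_var_lebesgue_integral)
qed

section \<open>Moments of the level entropies\<close>

lemma integral_double_sum:
  fixes f :: "'i \<Rightarrow> 'j \<Rightarrow> 'a \<Rightarrow> real"
  assumes "\<And>i j. i \<in> A \<Longrightarrow> j \<in> B \<Longrightarrow> integrable N (f i j)"
  shows "(\<integral>x. (\<Sum>i\<in>A. \<Sum>j\<in>B. f i j x) \<partial>N) = (\<Sum>i\<in>A. \<Sum>j\<in>B. \<integral>x. f i j x \<partial>N)"
  using assms by (subst Bochner_Integration.integral_sum)
    (auto intro!: Bochner_Integration.integrable_sum sum.cong Bochner_Integration.integral_sum)

text \<open>Shaped for repeated introduction: factors bounded by 1 are peeled off on the right while
  \<open>C\<close> is kept.\<close>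

lemma abs_mult_le: "\<bar>a\<bar> \<le> C \<Longrightarrow> \<bar>b\<bar> \<le> 1 \<Longrightarrow> \<bar>a * b\<bar> \<le> C" for a b C :: real
  unfolding abs_mult using mult_mono[of "\<bar>a\<bar>" C "\<bar>b\<bar>" 1] by auto

text \<open>The beta law enters the variance only through three moments per level, so the argument
  is run for arbitrary independent splits. The range condition holds at every point, which makes all
  functionals bounded and hence integrable.\<close>

locale splitting_tree = prob_space P for P :: "'w measure" +
  fixes M :: nat and X :: "'w \<Rightarrow> nat \<times> nat \<Rightarrow> real" and \<mu> \<eta> r :: "nat \<Rightarrow> real"
  assumes indep: "indep_vars (\<lambda>_. borel) (\<lambda>k \<omega>. X \<omega> k) (nodes M)"
    and range: "\<And>\<omega> k. 0 < X \<omega> k \<and> X \<omega> k < 1"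
    and mean: "\<And>m i. (m, i) \<in> nodes M \<Longrightarrow> expectation (\<lambda>\<omega>. neg_entropy (X \<omega> (m, i))) = \<mu> m"
    and mean_sq: "\<And>m i. (m, i) \<in> nodes M \<Longrightarrow> expectation (\<lambda>\<omega>. (neg_entropy (X \<omega> (m, i)))\<^sup>2) = \<eta> m"
    and mean_r: "\<And>m i. (m, i) \<in> nodes M \<Longrightarrow>
        expectation (\<lambda>\<omega>. (X \<omega> (m, i))\<^sup>2 + (1 - X \<omega> (m, i))\<^sup>2) = r m"
begin

lemma integrable_determined:
  assumes U: "determined_by U K" and K: "K \<subseteq> nodes M" and bound: "\<And>\<omega>. \<bar>U (X \<omega>)\<bar> \<le> C"
  shows "integrable P (\<lambda>\<omega>. U (X \<omega>))"
proof -
  have "(\<lambda>\<omega>. U (X \<omega>)) \<in> borel_measurable P"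
    using indep K by (intro determined_by_measurable[OF U]) (auto simp: indep_vars_def)
  then show ?thesis
    using bound by (intro integrable_const_bound[where B = C]) auto
qed

lemma expectation_mult:
  assumes k: "k \<in> nodes M - K" and K: "K \<subseteq> nodes M"
    and U: "determined_by U K" "\<And>\<omega>. \<bar>U (X \<omega>)\<bar> \<le> C"
    and g: "g \<in> borel_measurable borel" "\<And>\<omega>. \<bar>g (X \<omega> k)\<bar> \<le> D"
  shows "expectation (\<lambda>\<omega>. U (X \<omega>) * g (X \<omega> k)) = expectation (\<lambda>\<omega>. U (X \<omega>)) * expectation (\<lambda>\<omega>. g (X \<omega> k))"
  using k by (intro expectation_mult_determined[OF indep K k U(1) g(1)] integrable_determined[OF U(1) K U(2)]
      integrable_determined[where U = "\<lambda>x. g (x k)" and K = "{k}", OF determined_by_component])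
    (auto intro: g)

lemma abs_mass: "\<bar>mass (X \<omega>) n i\<bar> \<le> 1"
  using mass_pos[of "X \<omega>" n i] mass_le_1[of "X \<omega>" n i] range by simp

lemma abs_neg_entropy: "\<bar>neg_entropy (X \<omega> k)\<bar> \<le> 1"
  using neg_entropy_bound range by simp

lemma abs_entropy: "\<bar>level_entropy (X \<omega>) n\<bar> \<le> 1"
  using abs_level_entropy range by simp

text \<open>The martingale property in weak form. \<open>level_entropy\<close> at \<open>n\<close>
  uses the splits of level \<open>Suc n\<close>, which are independent of \<open>nodes n\<close>;
  after replacing their entropies by the mean, the masses sum to 1 and disappear.\<close>

lemma expectation_mult_level_entropy:
  assumes n: "n < M" and U: "determined_by U (nodes n)" "\<And>\<omega>. \<bar>U (X \<omega>)\<bar> \<le> C"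
  shows "expectation (\<lambda>\<omega>. U (X \<omega>) * level_entropy (X \<omega>) n) = \<mu> (Suc n) * expectation (\<lambda>\<omega>. U (X \<omega>))"
proof -
  have sub: "nodes n \<subseteq> nodes M" using n by (intro nodes_mono) auto
  have det: "determined_by (\<lambda>x. U x * mass x n i) (nodes n)" if "i \<in> {1..2 ^ n}" for i
    using U(1) that by (intro determined_by_mult determined_by_mass)
  have bnd: "\<bar>U (X \<omega>) * mass (X \<omega>) n i\<bar> \<le> C" for \<omega> i
    by (intro abs_mult_le U abs_mass)
  have int: "integrable P (\<lambda>\<omega>. U (X \<omega>) * mass (X \<omega>) n i)" if "i \<in> {1..2 ^ n}" for i
    using integrable_determined[OF det[OF that] sub bnd] .
  have "expectation (\<lambda>\<omega>. U (X \<omega>) * level_entropy (X \<omega>) n)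
      = expectation (\<lambda>\<omega>. \<Sum>i=1..2 ^ n. U (X \<omega>) * mass (X \<omega>) n i * neg_entropy (X \<omega> (Suc n, i)))"
    by (simp add: level_entropy_def sum_distrib_left mult.assoc)
  also have "\<dots> = (\<Sum>i=1..2 ^ n. expectation (\<lambda>\<omega>. U (X \<omega>) * mass (X \<omega>) n i * neg_entropy (X \<omega> (Suc n, i))))"
  proof (rule Bochner_Integration.integral_sum)
    fix i :: nat assume i: "i \<in> {1..2 ^ n}"
    have "determined_by (\<lambda>x. U x * mass x n i * neg_entropy (x (Suc n, i))) (nodes (Suc n))"
      using i by (intro determined_by_mult[OF determined_by_mono[OF det]] determined_by_component)
        (auto simp: Suc_nodes_iff nodes_mono)
    then show "integrable P (\<lambda>\<omega>. U (X \<omega>) * mass (X \<omega>) n i * neg_entropy (X \<omega> (Suc n, i)))"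
      by (rule integrable_determined[where C = C])
        (use n in \<open>auto intro!: nodes_mono abs_mult_le U abs_mass abs_neg_entropy simp: Suc_le_eq\<close>)
  qed
  also have "\<dots> = (\<Sum>i=1..2 ^ n. expectation (\<lambda>\<omega>. U (X \<omega>) * mass (X \<omega>) n i) * \<mu> (Suc n))"
  proof (intro sum.cong refl)
    fix i :: nat assume i: "i \<in> {1..2 ^ n}"
    have "(Suc n, i) \<in> nodes M - nodes n"
      using i n by (auto simp: Suc_nodes_iff)
    from expectation_mult[OF this sub det[OF i] bnd neg_entropy_measurable abs_neg_entropy] this
    show "expectation (\<lambda>\<omega>. U (X \<omega>) * mass (X \<omega>) n i * neg_entropy (X \<omega> (Suc n, i)))
        = expectation (\<lambda>\<omega>. U (X \<omega>) * mass (X \<omega>) n i) * \<mu> (Suc n)"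
      by (simp add: mean)
  qed
  also have "\<dots> = \<mu> (Suc n) * expectation (\<lambda>\<omega>. \<Sum>i=1..2 ^ n. U (X \<omega>) * mass (X \<omega>) n i)"
    by (subst Bochner_Integration.integral_sum[OF int]) (auto simp: sum_distrib_left mult.commute)
  also have "(\<lambda>\<omega>. \<Sum>i=1..2 ^ n. U (X \<omega>) * mass (X \<omega>) n i) = (\<lambda>\<omega>. U (X \<omega>))"
    by (simp only: sum_distrib_left[symmetric] sum_mass mult_1_right)
  finally show ?thesis .
qed

lemma expectation_level_entropy:
  "n < M \<Longrightarrow> expectation (\<lambda>\<omega>. level_entropy (X \<omega>) n) = \<mu> (Suc n)"
  using expectation_mult_level_entropy[of n "\<lambda>_. 1" 1] by (simp add: determined_by_const prob_space)

text \<open>The squares of the two child masses add up to the parent's square times a function of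
  one fresh split, whose mean is \<open>r\<close>; each level thus contributes one factor.\<close>

lemma sum_expectation_mass_sq:
  "n \<le> M \<Longrightarrow> (\<Sum>j=1..2 ^ n. expectation (\<lambda>\<omega>. (mass (X \<omega>) n j)\<^sup>2)) = (\<Prod>k=1..n. r k)"
proof (induction n)
  case 0
  then show ?case by (simp add: prob_space)
next
  case (Suc n)
  have sub: "nodes n \<subseteq> nodes M" "nodes (Suc n) \<subseteq> nodes M" using Suc.prems by (auto intro!: nodes_mono)
  have sq: "determined_by (\<lambda>x. (mass x m i)\<^sup>2) (nodes m)" if "i \<in> {1..2 ^ m}" for i m
    unfolding power2_eq_square using that by (intro determined_by_mult determined_by_mass)
  have sq_bound: "\<bar>(mass (X \<omega>) m i)\<^sup>2\<bar> \<le> 1" for \<omega> i m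
    unfolding power2_eq_square by (intro abs_mult_le abs_mass)
  have int: "integrable P (\<lambda>\<omega>. (mass (X \<omega>) (Suc n) j)\<^sup>2)" if "j \<in> {1..2 ^ Suc n}" for j
    using integrable_determined[OF sq[OF that] sub(2) sq_bound] .
  let ?g = "\<lambda>y::real. y\<^sup>2 + (1 - y)\<^sup>2"
  have "(\<Sum>j=1..2 ^ Suc n. expectation (\<lambda>\<omega>. (mass (X \<omega>) (Suc n) j)\<^sup>2))
      = (\<Sum>i=1..2 ^ n. expectation (\<lambda>\<omega>. (mass (X \<omega>) n i)\<^sup>2) * r (Suc n))"
    unfolding sum_children
  proof (intro sum.cong refl)
    fix i :: nat assume i: "i \<in> {1..2 ^ n}"
    have c: "2 * i - 1 \<in> {1..2 ^ Suc n}" "2 * i \<in> {1..2 ^ Suc n}" using i by auto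
    have k: "(Suc n, i) \<in> nodes M - nodes n"
      using i Suc.prems by (auto simp: Suc_nodes_iff)
    have "\<bar>?g (X \<omega> (Suc n, i))\<bar> \<le> 2" for \<omega>
      using range[of \<omega> "(Suc n, i)"] power_le_one[of "X \<omega> (Suc n, i)" 2]
        power_le_one[of "1 - X \<omega> (Suc n, i)" 2] by auto
    note e = expectation_mult[OF k sub(1) sq[OF i] sq_bound, of ?g 2, OF _ this]
    have "expectation (\<lambda>\<omega>. (mass (X \<omega>) (Suc n) (2 * i - 1))\<^sup>2) + expectation (\<lambda>\<omega>. (mass (X \<omega>) (Suc n) (2 * i))\<^sup>2)
        = expectation (\<lambda>\<omega>. (mass (X \<omega>) (Suc n) (2 * i - 1))\<^sup>2 + (mass (X \<omega>) (Suc n) (2 * i))\<^sup>2)"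
      using int[OF c(1)] int[OF c(2)] by simp
    also have "\<dots> = expectation (\<lambda>\<omega>. (mass (X \<omega>) n i)\<^sup>2 * ?g (X \<omega> (Suc n, i)))"
      using i by (simp add: power_mult_distrib distrib_left)
    also have "\<dots> = expectation (\<lambda>\<omega>. (mass (X \<omega>) n i)\<^sup>2) * r (Suc n)"
      using e k by (simp add: mean_r)
    finally show "expectation (\<lambda>\<omega>. (mass (X \<omega>) (Suc n) (2 * i - 1))\<^sup>2) + expectation (\<lambda>\<omega>. (mass (X \<omega>) (Suc n) (2 * i))\<^sup>2)
        = expectation (\<lambda>\<omega>. (mass (X \<omega>) n i)\<^sup>2) * r (Suc n)" .
  qed
  also have "\<dots> = (\<Prod>k=1..Suc n. r k)"
    using Suc by (simp add: sum_distrib_right[symmetric])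
  finally show ?case .
qed

text \<open>Distinct splits of a level are independent of each other and of the masses, so only the
  diagonal of the expanded square feels their variance, weighted by the squared masses.\<close>

lemma expectation_level_entropy_sq:
  assumes n: "n < M"
  shows "expectation (\<lambda>\<omega>. (level_entropy (X \<omega>) n)\<^sup>2)
    = (\<mu> (Suc n))\<^sup>2 + (\<eta> (Suc n) - (\<mu> (Suc n))\<^sup>2) * (\<Prod>k=1..n. r k)"
proof -
  let ?A = "{1..2 ^ n} :: nat set"
  let ?l = "\<mu> (Suc n)" and ?e = "\<eta> (Suc n)"
  let ?m = "\<lambda>i \<omega>. mass (X \<omega>) n i" and ?h = "\<lambda>i \<omega>. neg_entropy (X \<omega> (Suc n, i))"
  have sub: "nodes n \<subseteq> nodes M" "nodes (Suc n) \<subseteq> nodes M" using n by (auto intro!: nodes_mono)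
  have det: "determined_by (\<lambda>x. mass x n i * mass x n j) (nodes n)" if "i \<in> ?A" "j \<in> ?A" for i j
    using that by (intro determined_by_mult determined_by_mass)
  have bnd: "\<bar>?m i \<omega> * ?m j \<omega>\<bar> \<le> 1" for i j \<omega>
    by (intro abs_mult_le abs_mass)
  have int: "integrable P (\<lambda>\<omega>. ?m i \<omega> * ?m j \<omega>)" if "i \<in> ?A" "j \<in> ?A" for i j
    using integrable_determined[OF det[OF that] sub(1) bnd] .
  have node: "(Suc n, i) \<in> nodes M - nodes n" if "i \<in> ?A" for i
    using that n by (auto simp: Suc_nodes_iff)
  \<comment> \<open>The diagonal value is split into the off-diagonal formula plus a correction, so
    that the first part can be summed over all pairs.\<close>
  have pair: "expectation (\<lambda>\<omega>. ?m i \<omega> * ?m j \<omega> * ?h j \<omega> * ?h i \<omega>)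
      = ?l\<^sup>2 * expectation (\<lambda>\<omega>. ?m i \<omega> * ?m j \<omega>)
        + (if i = j then (?e - ?l\<^sup>2) * expectation (\<lambda>\<omega>. (?m i \<omega>)\<^sup>2) else 0)"
    if i: "i \<in> ?A" and j: "j \<in> ?A" for i j
  proof (cases "i = j")
    case True
    have "\<bar>(?h i \<omega>)\<^sup>2\<bar> \<le> 1" for \<omega>
      unfolding power2_eq_square by (intro abs_mult_le abs_neg_entropy)
    then have "expectation (\<lambda>\<omega>. ?m i \<omega> * ?m i \<omega> * (?h i \<omega>)\<^sup>2)
        = expectation (\<lambda>\<omega>. ?m i \<omega> * ?m i \<omega>) * expectation (\<lambda>\<omega>. (?h i \<omega>)\<^sup>2)"
      by (intro expectation_mult[OF node[OF i] sub(1) det[OF i i] bnd, of "\<lambda>y. (neg_entropy y)\<^sup>2"]) auto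
    moreover have "(\<lambda>\<omega>. ?m i \<omega> * ?m j \<omega> * ?h j \<omega> * ?h i \<omega>) = (\<lambda>\<omega>. ?m i \<omega> * ?m i \<omega> * (?h i \<omega>)\<^sup>2)"
      using True by (simp add: power2_eq_square mult.assoc)
    moreover have "(\<lambda>\<omega>. (?m i \<omega>)\<^sup>2) = (\<lambda>\<omega>. ?m i \<omega> * ?m i \<omega>)"
      by (simp add: power2_eq_square)
    moreover have "expectation (\<lambda>\<omega>. (?h i \<omega>)\<^sup>2) = ?e"
      using node[OF i] by (simp add: mean_sq)
    ultimately show ?thesis
      using True by (simp only: if_True left_diff_distrib) simp
  next
    case False
    \<comment> \<open>Independence is used twice: split \<open>i\<close> is first separated from the
      past enlarged by split \<open>j\<close>, and then split \<open>j\<close> from the past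
      itself.\<close>
    let ?K = "insert (Suc n, j) (nodes n)"
    have 1: "determined_by (\<lambda>x. mass x n i * mass x n j * neg_entropy (x (Suc n, j))) ?K"
      by (intro determined_by_mult[OF determined_by_mono[OF det[OF i j]]] determined_by_component) auto
    have "expectation (\<lambda>\<omega>. ?m i \<omega> * ?m j \<omega> * ?h j \<omega> * ?h i \<omega>)
        = expectation (\<lambda>\<omega>. ?m i \<omega> * ?m j \<omega> * ?h j \<omega>) * expectation (?h i)"
      using node[OF i] node[OF j] sub False
      by (intro expectation_mult[OF _ _ 1, where C = 1 and D = 1])
        (auto intro!: abs_mult_le abs_mass abs_neg_entropy)
    also have "expectation (\<lambda>\<omega>. ?m i \<omega> * ?m j \<omega> * ?h j \<omega>)
        = expectation (\<lambda>\<omega>. ?m i \<omega> * ?m j \<omega>) * expectation (?h j)"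
      by (rule expectation_mult[OF node[OF j] sub(1) det[OF i j] bnd neg_entropy_measurable abs_neg_entropy])
    finally show ?thesis
      using node[OF i] node[OF j] False by (simp add: mean power2_eq_square)
  qed
  have "expectation (\<lambda>\<omega>. (level_entropy (X \<omega>) n)\<^sup>2)
      = expectation (\<lambda>\<omega>. \<Sum>i\<in>?A. \<Sum>j\<in>?A. ?m i \<omega> * ?m j \<omega> * ?h j \<omega> * ?h i \<omega>)"
    unfolding level_entropy_def power2_eq_square sum_product
    by (simp add: ac_simps)
  also have "\<dots> = (\<Sum>i\<in>?A. \<Sum>j\<in>?A. expectation (\<lambda>\<omega>. ?m i \<omega> * ?m j \<omega> * ?h j \<omega> * ?h i \<omega>))"
  proof -
    have "integrable P (\<lambda>\<omega>. ?m i \<omega> * ?m j \<omega> * ?h j \<omega> * ?h i \<omega>)" if i: "i \<in> ?A" and j: "j \<in> ?A" for i j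
    proof (rule integrable_determined[OF _ sub(2)])
      show "determined_by (\<lambda>x. mass x n i * mass x n j * neg_entropy (x (Suc n, j))
          * neg_entropy (x (Suc n, i))) (nodes (Suc n))"
        using i j by (intro determined_by_mult[OF determined_by_mult[OF determined_by_mono[OF det[OF i j]]]]
            determined_by_component) (auto simp: Suc_nodes_iff nodes_mono)
      show "\<bar>?m i \<omega> * ?m j \<omega> * ?h j \<omega> * ?h i \<omega>\<bar> \<le> 1" for \<omega>
        by (intro abs_mult_le abs_mass abs_neg_entropy)
    qed
    then show ?thesis
      by (rule integral_double_sum)
  qed
  also have "\<dots> = (\<Sum>i\<in>?A. \<Sum>j\<in>?A. ?l\<^sup>2 * expectation (\<lambda>\<omega>. ?m i \<omega> * ?m j \<omega>)
        + (if i = j then (?e - ?l\<^sup>2) * expectation (\<lambda>\<omega>. (?m i \<omega>)\<^sup>2) else 0))"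
    by (intro sum.cong refl pair)
  also have "\<dots> = ?l\<^sup>2 * (\<Sum>i\<in>?A. \<Sum>j\<in>?A. expectation (\<lambda>\<omega>. ?m i \<omega> * ?m j \<omega>))
      + (?e - ?l\<^sup>2) * (\<Sum>i\<in>?A. expectation (\<lambda>\<omega>. (?m i \<omega>)\<^sup>2))"
    by (simp add: sum.distrib sum_distrib_left)
  also have "(\<Sum>i\<in>?A. \<Sum>j\<in>?A. expectation (\<lambda>\<omega>. ?m i \<omega> * ?m j \<omega>))
      = expectation (\<lambda>\<omega>. \<Sum>i\<in>?A. \<Sum>j\<in>?A. ?m i \<omega> * ?m j \<omega>)"
    using int by (rule integral_double_sum[symmetric])
  \<comment> \<open>The double sum is the square of the total mass.\<close>
  also have "(\<lambda>\<omega>. \<Sum>i\<in>?A. \<Sum>j\<in>?A. ?m i \<omega> * ?m j \<omega>) = (\<lambda>\<omega>. 1)"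
    by (simp only: sum_product[symmetric] sum_mass mult_1_right)
  finally show ?thesis
    using n by (simp add: sum_expectation_mass_sq[simplified] prob_space)
qed

lemma integrable_centered:
  assumes "m < M" "n < M"
  shows "integrable P (\<lambda>\<omega>. level_entropy (X \<omega>) m)"
    "integrable P (\<lambda>\<omega>. level_entropy (X \<omega>) m * level_entropy (X \<omega>) n)"
proof -
  have sub: "nodes (Suc m) \<subseteq> nodes M" "nodes (Suc n) \<subseteq> nodes M" using assms by (auto intro!: nodes_mono)
  show "integrable P (\<lambda>\<omega>. level_entropy (X \<omega>) m)"
    by (rule integrable_determined[OF determined_by_level_entropy sub(1) abs_entropy])
  have "determined_by (\<lambda>x. level_entropy x m * level_entropy x n) (nodes M)"
    by (intro determined_by_mult determined_by_mono[OF determined_by_level_entropy] sub)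
  then show "integrable P (\<lambda>\<omega>. level_entropy (X \<omega>) m * level_entropy (X \<omega>) n)"
    by (rule integrable_determined[where C = 1]) (auto intro: abs_mult_le abs_entropy)
qed

text \<open>Since \<open>Suc m \<le> n\<close>, the earlier level entropy belongs to the past of
  level \<open>n\<close>, and the weak martingale property applies.\<close>

lemma expectation_level_entropy_mult:
  assumes "m < n" "n < M"
  shows "expectation (\<lambda>\<omega>. level_entropy (X \<omega>) m * level_entropy (X \<omega>) n) = \<mu> (Suc m) * \<mu> (Suc n)"
proof -
  have "determined_by (\<lambda>x. level_entropy x m) (nodes n)"
    using determined_by_level_entropy by (rule determined_by_mono) (use assms in \<open>simp add: nodes_mono\<close>)
  from expectation_mult_level_entropy[OF assms(2) this abs_entropy] show ?thesis
    using assms by (simp add: expectation_level_entropy)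
qed

lemma
  defines "S \<equiv> \<lambda>\<omega>. \<Sum>n<M. level_entropy (X \<omega>) n"
  shows integrable_entropy: "integrable P S"
    and integrable_entropy_sq: "integrable P (\<lambda>\<omega>. (S \<omega>)\<^sup>2)"
    and expectation_entropy: "expectation S = (\<Sum>n<M. \<mu> (Suc n))"
    and variance_entropy: "variance S
      = (\<Sum>n<M. (\<Prod>k=1..n. r k) * (\<eta> (Suc n) - (\<mu> (Suc n))\<^sup>2))"
proof -
  let ?L = "\<lambda>n \<omega>. level_entropy (X \<omega>) n"
  show S: "integrable P S"
    unfolding S_def by (intro Bochner_Integration.integrable_sum integrable_centered) auto
  have sq: "(S \<omega>)\<^sup>2 = (\<Sum>m<M. \<Sum>n<M. ?L m \<omega> * ?L n \<omega>)" for \<omega>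
    by (simp add: S_def power2_eq_square sum_product)
  show S2: "integrable P (\<lambda>\<omega>. (S \<omega>)\<^sup>2)"
    unfolding sq by (intro Bochner_Integration.integrable_sum integrable_centered) auto
  show E: "expectation S = (\<Sum>n<M. \<mu> (Suc n))"
    unfolding S_def using integrable_centered(1)
    by (subst Bochner_Integration.integral_sum) (auto intro!: sum.cong expectation_level_entropy)
  \<comment> \<open>The products of means sum to the squared mean of \<open>S\<close>, so only the
    diagonal corrections reach the variance.\<close>
  have "expectation (\<lambda>\<omega>. ?L m \<omega> * ?L n \<omega>)
      = \<mu> (Suc m) * \<mu> (Suc n) + (if m = n then (\<Prod>k=1..n. r k) * (\<eta> (Suc n) - (\<mu> (Suc n))\<^sup>2) else 0)"
    if "m < M" "n < M" for m n
    using that expectation_level_entropy_mult[of m n] expectation_level_entropy_mult[of n m]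
      expectation_level_entropy_sq[of n]
    by (cases m n rule: linorder_cases) (simp_all add: power2_eq_square mult.commute)
  then have "expectation (\<lambda>\<omega>. (S \<omega>)\<^sup>2)
      = (\<Sum>m<M. \<Sum>n<M. \<mu> (Suc m) * \<mu> (Suc n)
          + (if m = n then (\<Prod>k=1..n. r k) * (\<eta> (Suc n) - (\<mu> (Suc n))\<^sup>2) else 0))"
    unfolding sq using integrable_centered(2) by (subst integral_double_sum) auto
  also have "\<dots> = (\<Sum>n<M. \<mu> (Suc n))\<^sup>2 + (\<Sum>n<M. (\<Prod>k=1..n. r k) * (\<eta> (Suc n) - (\<mu> (Suc n))\<^sup>2))"
    by (simp add: sum.distrib power2_eq_square sum_product)
  finally show "variance S = (\<Sum>n<M. (\<Prod>k=1..n. r k) * (\<eta> (Suc n) - (\<mu> (Suc n))\<^sup>2))"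
    using variance_eq[OF S S2] E by simp
qed

end

section \<open>Cells and the divergence\<close>

lemma ceiling_half: "nat \<lceil>real i / 2\<rceil> = parent i"
  unfolding parent_def by linarith

lemma ancestor_self [simp]: "ancestor m j m = j"
  by (simp add: ancestor_def)

lemma ancestor_Suc: "k \<le> m \<Longrightarrow> ancestor (Suc m) j k = ancestor m (parent j) k"
  by (simp add: ancestor_def Suc_diff_le funpow_Suc_right ceiling_half del: funpow.simps)

lemma ancestor_in: "k \<le> m \<Longrightarrow> j \<in> {1..2 ^ m} \<Longrightarrow> ancestor m j k \<in> {1..2 ^ k}"
proof (induction m arbitrary: j)
  case (Suc m)
  then show ?case
    using parent_in[of j m] by (cases "k = Suc m") (simp_all add: ancestor_Suc)
qed auto

lemma mass_eq_prod: "mass x m j = (\<Prod>k=1..m. branch x k (ancestor m j k))"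
proof (induction m arbitrary: j)
  case (Suc m)
  then show ?case by (simp add: ancestor_Suc)
qed simp

text \<open>The theorem multiplies along the path from the node upwards; reversing the range gives
  the order from the root.\<close>

lemma prod_ancestors:
  "(\<Prod>k=1..m. y (m - k + 1) (ancestor m j (m - k + 1))) = (\<Prod>k=1..m. y k (ancestor m j k))"
  for y :: "nat \<Rightarrow> nat \<Rightarrow> real"
  by (subst prod.atLeastAtMost_rev) (intro prod.cong refl, auto simp: Suc_diff_le)

section \<open>Quantiles of a continuous distribution\<close>

lemma (in real_distribution) quantile_mono:
  assumes "p \<le> q"
  shows "quantile M p \<le> quantile M q"
proof -
  have "Inf {x. p \<le> cdf M x} \<le> Inf {x. q \<le> cdf M x}" if pq: "0 < p" "q < 1"
  proof (rule cInf_superset_mono)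
    \<comment> \<open>The limits of the distribution function make the sets nonempty and bounded
      below, so that \<open>Inf\<close> is a genuine infimum.\<close>
    have "eventually (\<lambda>x. q < cdf M x) at_top"
      using cdf_lim_at_top_prob pq(2) by (rule order_tendstoD)
    then show "{x. q \<le> cdf M x} \<noteq> {}"
      by (auto simp: eventually_at_top_linorder intro: less_imp_le)
    have "eventually (\<lambda>x. cdf M x < p) at_bot"
      using cdf_lim_at_bot pq(1) by (rule order_tendstoD)
    then obtain b where b: "cdf M x < p" if "x \<le> b" for x
      by (auto simp: eventually_at_bot_linorder)
    have "b \<le> x" if "p \<le> cdf M x" for x
      using b[of x] that by linarith
    then show "bdd_below {x. p \<le> cdf M x}"
      by (intro bdd_belowI) auto
    show "{x. q \<le> cdf M x} \<subseteq> {x. p \<le> cdf M x}"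
      using assms by auto
  qed
  then show ?thesis using assms by (auto simp: quantile_def)
qed

text \<open>By continuity the set defining the quantile is closed and contains its infimum, so the
  distribution function is at least \<open>p\<close> there. The intermediate value theorem gives a
  point with value exactly \<open>p\<close>, not below the infimum, hence equality even if the
  function has flat pieces.\<close>

lemma (in real_distribution) prob_le_quantile:
  assumes cont: "\<And>x. isCont (cdf M) x" and p: "0 \<le> p" "p \<le> 1"
  shows "prob {x. ereal x \<le> quantile M p} = p"
proof -
  consider "p = 0" | "p = 1" | "0 < p" "p < 1" using p by linarith
  then show ?thesis
  proof cases
    case 3
    let ?A = "{x. p \<le> cdf M x}"
    have "eventually (\<lambda>x. p < cdf M x) at_top"
      using cdf_lim_at_top_prob 3(2) by (rule order_tendstoD)
    then obtain u where u: "p < cdf M u" by (auto simp: eventually_at_top_linorder)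
    have "eventually (\<lambda>x. cdf M x < p) at_bot"
      using cdf_lim_at_bot 3(1) by (rule order_tendstoD)
    then obtain b where b: "cdf M x < p" if "x \<le> b" for x
      by (auto simp: eventually_at_bot_linorder)
    have "b \<le> x" if "p \<le> cdf M x" for x
      using b[of x] that by linarith
    then have bdd: "bdd_below ?A"
      by (intro bdd_belowI) auto
    have bu: "b \<le> u" using b[of u] u by (cases "b \<le> u") auto
    obtain x where x: "cdf M x = p"
      using IVT[of "cdf M" b p u] b[of b] u cont bu by auto
    have "cdf M (Inf ?A) \<le> cdf M x"
      using bdd x by (intro cdf_nondecreasing cInf_lower) auto
    moreover have "closed ?A"
      using cont by (intro closed_Collect_le continuous_intros) (simp add: continuous_on_eq_continuous_at)
    then have "Inf ?A \<in> ?A"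
      using x bdd by (intro closed_contains_Inf) auto
    ultimately have "cdf M (Inf ?A) = p" using x by simp
    then show ?thesis using 3 by (simp add: quantile_def cdf_def atMost_def)
  qed (use prob_space in \<open>simp_all add: quantile_def\<close>)
qed

section \<open>Dyadic cells and their ancestors\<close>

lemma cell_Suc:
  assumes M: "real_distribution F0" and j: "1 \<le> j" and x: "x \<in> cell F0 (Suc m) j"
  shows "x \<in> cell F0 m (parent j)"
proof -
  interpret real_distribution F0 by fact
  have "2 * real (parent j) - 2 \<le> real j - 1" "real j \<le> 2 * real (parent j)"
    using j by (auto simp: parent_def)
  then have "(2 * real (parent j) - 2) / 2 ^ Suc m \<le> (real j - 1) / 2 ^ Suc m"
    "real j / 2 ^ Suc m \<le> 2 * real (parent j) / 2 ^ Suc m"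
    by (simp_all only: divide_right_mono zero_le_power zero_le_numeral)
  then have "(real (parent j) - 1) / 2 ^ m \<le> (real j - 1) / 2 ^ Suc m"
    "real j / 2 ^ Suc m \<le> real (parent j) / 2 ^ m"
    by (simp_all add: diff_divide_distrib)
  from this[THEN quantile_mono] x show ?thesis
    by (auto simp: cell_def intro: order.strict_trans1 order_trans)
qed

lemma cell_ancestor:
  assumes M: "real_distribution F0"
  shows "k \<le> m \<Longrightarrow> j \<in> {1..2 ^ m} \<Longrightarrow> x \<in> cell F0 m j \<Longrightarrow> x \<in> cell F0 k (ancestor m j k)"
proof (induction m arbitrary: j)
  case (Suc m)
  then show ?case
    using parent_in[of j m] cell_Suc[OF M, of j x m]
    by (cases "k = Suc m") (simp_all add: ancestor_Suc)
qed simp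

lemma cell_disjoint:
  assumes M: "real_distribution F0" and x: "x \<in> cell F0 m i" "x \<in> cell F0 m j"
  shows "i = j"
proof -
  interpret real_distribution F0 by fact
  have False if "i < j" "x \<in> cell F0 m i" "x \<in> cell F0 m j" for i j
  proof -
    have "quantile F0 (real i / 2 ^ m) \<le> quantile F0 ((real j - 1) / 2 ^ m)"
      using that(1) by (intro quantile_mono divide_right_mono) auto
    with that(2,3) show False by (auto simp: cell_def)
  qed
  with x show ?thesis by (metis linorder_neqE_nat)
qed

text \<open>The index is the least one whose right endpoint is not below \<open>x\<close>. The
  infinite quantiles at 0 and 1 make \<open>2 ^ m\<close> qualify and 0 fail, so points outside the
  support of \<open>F0\<close> are covered too.\<close>

lemma cell_exists: "\<exists>j\<in>{1..2 ^ m}. x \<in> cell F0 m j"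
proof -
  let ?P = "\<lambda>j. ereal x \<le> quantile F0 (real j / 2 ^ m)"
  have top: "?P (2 ^ m)" and "\<not> ?P 0" by (auto simp: quantile_def)
  define j where "j = (LEAST j. ?P j)"
  have j: "?P j" "j \<le> 2 ^ m"
    unfolding j_def by (rule LeastI[of ?P, OF top], rule Least_le[of ?P, OF top])
  with \<open>\<not> ?P 0\<close> have "1 \<le> j" by (cases j) auto
  moreover have "\<not> ?P (j - 1)"
    using not_less_Least[of "j - 1" ?P] \<open>1 \<le> j\<close> by (auto simp: j_def)
  ultimately show ?thesis
    using j by (intro bexI[of _ j]) (auto simp: cell_def of_nat_diff not_le)
qed

text \<open>Cells of one level are disjoint, so the definite description has a unique solution, and
  nesting of the cells shows that the ancestor solves it.\<close>

lemma cell_index_eq: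
  assumes M: "real_distribution F0" and "k \<le> m" "j \<in> {1..2 ^ m}" "x \<in> cell F0 m j"
  shows "cell_index F0 k x = ancestor m j k"
  unfolding cell_index_def
proof (rule the_equality)
  show *: "ancestor m j k \<in> {1..2 ^ k} \<and> x \<in> cell F0 k (ancestor m j k)"
    using assms ancestor_in[of k m j] cell_ancestor[OF M, of k m j x] by simp
  show "i = ancestor m j k" if "i \<in> {1..2 ^ k} \<and> x \<in> cell F0 k i" for i
    using that * cell_disjoint[OF M] by blast
qed

lemma cell_sets [measurable]: "cell F0 m j \<in> sets borel"
  unfolding cell_def by measurable

lemma measure_cell:
  assumes M: "real_distribution F0" and cont: "\<And>x. isCont (cdf F0) x" and j: "j \<in> {1..2 ^ m}"
  shows "measure F0 (cell F0 m j) = 1 / 2 ^ m"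
proof -
  interpret real_distribution F0 by fact
  let ?A = "\<lambda>p. {x. ereal x \<le> quantile F0 p}"
  have "cell F0 m j = ?A (real j / 2 ^ m) - ?A ((real j - 1) / 2 ^ m)"
    by (auto simp: cell_def)
  also have "prob \<dots> = prob (?A (real j / 2 ^ m)) - prob (?A ((real j - 1) / 2 ^ m))"
  proof (rule finite_measure_Diff)
    show "?A ((real j - 1) / 2 ^ m) \<subseteq> ?A (real j / 2 ^ m)"
      using quantile_mono[of "(real j - 1) / 2 ^ m" "real j / 2 ^ m"]
      by (auto simp: divide_right_mono intro: order_trans)
  qed auto
  also have "prob (?A (real j / 2 ^ m)) - prob (?A ((real j - 1) / 2 ^ m)) = real j / 2 ^ m - (real j - 1) / 2 ^ m"
  proof -
    have "real j \<le> real (2 ^ m)"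
      using j unfolding of_nat_le_iff by simp
    then have 1: "real j / 2 ^ m \<le> 1"
      by (simp add: divide_le_eq_1)
    have "(real j - 1) / 2 ^ m \<le> real j / 2 ^ m"
      by (intro divide_right_mono) auto
    then have 2: "(real j - 1) / 2 ^ m \<le> 1"
      using 1 by linarith
    have 3: "0 \<le> real j / 2 ^ m" "0 \<le> (real j - 1) / 2 ^ m"
      using j by simp_all
    show ?thesis
      by (simp only: prob_le_quantile[OF cont 3(1) 1] prob_le_quantile[OF cont 3(2) 2])
  qed
  finally show ?thesis by (simp add: field_simps)
qed

section \<open>The divergence as a finite sum\<close>

lemma has_density_distribution:
  assumes F0: "prob_space F0" "has_density F0 f0"
  shows "real_distribution F0" "isCont (cdf F0) x"
    "A \<in> sets borel \<Longrightarrow> has_bochner_integral lborel (\<lambda>x. indicator A x * f0 x) (measure F0 A)"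
proof -
  interpret prob_space F0 by fact
  have F0_eq: "F0 = density lborel (\<lambda>x. ennreal (f0 x))"
    and [measurable]: "f0 \<in> borel_measurable borel" and nn: "\<And>x. 0 \<le> f0 x"
    using F0(2) by (auto simp: has_density_def)
  have "sets F0 = sets borel" unfolding F0_eq by simp
  then show dist: "real_distribution F0" by unfold_locales
  interpret real_distribution F0 by fact
  have int: "has_bochner_integral lborel (\<lambda>x. indicator A x * f0 x) (measure F0 A)" if "A \<in> sets borel" for A
  proof (rule has_bochner_integral_nn_integral)
    have "(\<integral>\<^sup>+x. ennreal (indicator A x * f0 x) \<partial>lborel) = (\<integral>\<^sup>+x. ennreal (f0 x) * indicator A x \<partial>lborel)"
      by (intro nn_integral_cong) (simp split: split_indicator)
    also have "\<dots> = emeasure F0 A"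
      unfolding F0_eq using that by (subst emeasure_density) auto
    finally show "(\<integral>\<^sup>+x. ennreal (indicator A x * f0 x) \<partial>lborel) = ennreal (measure F0 A)"
      by (simp add: emeasure_eq_measure)
  qed (use that nn in auto)
  then show "A \<in> sets borel \<Longrightarrow> has_bochner_integral lborel (\<lambda>x. indicator A x * f0 x) (measure F0 A)" .
  \<comment> \<open>A singleton is a Lebesgue null set, so \<open>F0\<close> has no atoms.\<close>
  have "emeasure F0 {x} = (\<integral>\<^sup>+y. ennreal (f0 y) * indicator {x} y \<partial>lborel)"
    unfolding F0_eq by (subst emeasure_density) auto
  also have "\<dots> = 0" by simp
  finally show "isCont (cdf F0) x"
    by (subst isCont_cdf) (simp add: measure_def)
qed

text \<open>On a cell the integrand is a constant multiple of \<open>f0\<close>, and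
  \<open>F0\<close> gives each cell probability \<open>1 / 2 ^ m\<close>, so the integral reduces to
  a finite sum.\<close>

lemma kl_piecewise_constant_ratio:
  assumes F0: "prob_space F0" "has_density F0 f0"
    and f: "\<And>j x. j \<in> {1..2 ^ m} \<Longrightarrow> x \<in> cell F0 m j \<Longrightarrow> f x = c j * f0 x"
  shows "integrable lborel (kl_integrand f f0)"
    and "kl f f0 = (\<Sum>j=1..2 ^ m. c j * ln (c j) / 2 ^ m)"
proof -
  note dist = has_density_distribution[OF F0]
  have integrand: "kl_integrand f f0 x = (\<Sum>j=1..2 ^ m. c j * ln (c j) * (indicator (cell F0 m j) x * f0 x))" for x
  proof -
    obtain i where i: "i \<in> {1..2 ^ m}" "x \<in> cell F0 m i" using cell_exists by (rule bexE)
    then have "x \<in> cell F0 m j \<longleftrightarrow> j = i" for j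
      using cell_disjoint[OF dist(1)] by blast
    then have "(\<Sum>j=1..2 ^ m. c j * ln (c j) * (indicator (cell F0 m j) x * f0 x))
        = (\<Sum>j=1..2 ^ m. if j = i then c j * ln (c j) * f0 x else 0)"
      by (intro sum.cong refl) (simp add: indicator_def)
    also have "\<dots> = c i * ln (c i) * f0 x" using i by simp
    \<comment> \<open>Where \<open>f0\<close> vanishes so does \<open>f\<close>, and both sides are
      0 whatever the quotient inside the logarithm is.\<close>
    also have "\<dots> = kl_integrand f f0 x"
      using f[OF i] by (cases "f0 x = 0") (simp_all add: kl_integrand_def)
    finally show ?thesis ..
  qed
  have "has_bochner_integral lborel
      (\<lambda>x. \<Sum>j=1..2 ^ m. c j * ln (c j) * (indicator (cell F0 m j) x * f0 x))
      (\<Sum>j=1..2 ^ m. c j * ln (c j) * (1 / 2 ^ m))"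
  proof (intro has_bochner_integral_sum has_bochner_integral_mult_right)
    show "has_bochner_integral lborel (\<lambda>x. indicator (cell F0 m j) x * f0 x) (1 / 2 ^ m)"
      if "j \<in> {1..2 ^ m}" for j
      using dist(3)[OF cell_sets[of F0 m j]] measure_cell[OF dist(1,2) that] by simp
  qed
  then have "has_bochner_integral lborel (kl_integrand f f0) (\<Sum>j=1..2 ^ m. c j * ln (c j) / 2 ^ m)"
    unfolding integrand[symmetric] by simp
  then show "integrable lborel (kl_integrand f f0)" "kl f f0 = (\<Sum>j=1..2 ^ m. c j * ln (c j) / 2 ^ m)"
    by (auto simp: has_bochner_integral_iff kl_def)
qed

section \<open>Mean and variance\<close>

text \<open>Each summand is the difference of two consecutive partial products, so the sum
  telescopes.\<close>

lemma sum_split_prod: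
  fixes r :: "nat \<Rightarrow> real"
  shows "(\<Sum>j=1..n. (1 - r j) * (\<Prod>k=1..j-1. r k)) = 1 - (\<Prod>k=1..n. r k)"
  by (induction n) (simp_all add: algebra_simps)

lemma sum_half_powers: "(\<Sum>j=1..n. (1 / 2) ^ j) = 1 - (1 / 2 :: real) ^ n"
  by (induction n) simp_all

text \<open>Hence the double sum over \<open>m < j\<close> in \<open>B\<close> vanishes.\<close>

lemma lambda_mixture:
  assumes "0 < \<alpha> * \<rho> m"
  shows "(\<alpha> * \<rho> m + 1) / (2 * \<alpha> * \<rho> m + 1) * lambda3 \<alpha> \<rho> m
    + (\<alpha> * \<rho> m) / (2 * \<alpha> * \<rho> m + 1) * lambda4 \<alpha> \<rho> m = lambda2 \<alpha> \<rho> m"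
proof -
  define a where "a = \<alpha> * \<rho> m"
  have a: "0 < a" using assms by (simp add: a_def)
  have 1: "Digamma (a + 2) = Digamma (a + 1) + 1 / (a + 1)"
    using Digamma_plus1[of "a + 1"] a by (simp add: add.assoc)
  have 2: "Digamma (2 * a + 2) = Digamma (2 * a + 1) + 1 / (2 * a + 1)"
    using Digamma_plus1[of "2 * a + 1"] a by (simp add: add.assoc)
  have "(a + 1) / (2 * a + 1) * (Digamma (a + 2) - Digamma (2 * a + 2))
      + a / (2 * a + 1) * (Digamma (a + 1) - Digamma (2 * a + 2)) = Digamma (a + 1) - Digamma (2 * a + 1)"
  proof -
    have "(a + 1) / (2 * a + 1) * (u + 1 / (a + 1) - (v + 1 / (2 * a + 1)))
        + a / (2 * a + 1) * (u - (v + 1 / (2 * a + 1))) = u - v" for u v :: real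
    proof -
      have "2 * a + 1 \<noteq> 0" "a + 1 \<noteq> 0" using a by auto
      then show ?thesis by (simp add: divide_simps) algebra
    qed
    then show ?thesis unfolding 1 2 .
  qed
  then show ?thesis
    by (simp add: lambda2_def lambda3_def lambda4_def a_def mult.assoc)
qed

lemma var_A_plus_var_B:
  fixes \<alpha> :: real and \<rho> :: "nat \<Rightarrow> real"
  assumes pos: "\<forall>m\<ge>1. 0 < \<alpha> * \<rho> m"
  defines "r \<equiv> \<lambda>k. (\<alpha> * \<rho> k + 1) / (2 * \<alpha> * \<rho> k + 1)"
  defines "s \<equiv> \<lambda>k. (\<alpha> * \<rho> k) / (2 * \<alpha> * \<rho> k + 1)"
  shows "var_A M \<alpha> \<rho> + var_B M \<alpha> \<rho>
    = (\<Sum>m=1..M. (\<Prod>k=1..m-1. r k) *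
        (r m * lambda5 \<alpha> \<rho> m + s m * lambda6 \<alpha> \<rho> m - (lambda2 \<alpha> \<rho> m)\<^sup>2))"
proof -
  have s: "s k = 1 - r k" if "1 \<le> k" for k
  proof -
    have "0 < \<alpha> * \<rho> k" using pos that by blast
    then have "2 * \<alpha> * \<rho> k + 1 \<noteq> 0" by (simp add: mult.assoc)
    then show ?thesis by (simp add: r_def s_def field_simps)
  qed
  have "((\<Prod>k=1..m. r k) * lambda5 \<alpha> \<rho> m - (1 / 2) ^ m * (lambda2 \<alpha> \<rho> m)\<^sup>2)
      + (s m * (\<Prod>k=1..m-1. r k) * lambda6 \<alpha> \<rho> m - (1 / 2) ^ m * (lambda2 \<alpha> \<rho> m)\<^sup>2
        + (\<Sum>j=1..m-1. s j * (\<Prod>k=1..j-1. r k) * (lambda2 \<alpha> \<rho> m)\<^sup>2 - (1 / 2) ^ j * (lambda2 \<alpha> \<rho> m)\<^sup>2)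
        + 2 * (\<Prod>k=1..m-1. r k) * (\<Sum>j=m+1..M. r m * lambda3 \<alpha> \<rho> m * lambda2 \<alpha> \<rho> j
            + s m * lambda4 \<alpha> \<rho> m * lambda2 \<alpha> \<rho> j - lambda2 \<alpha> \<rho> m * lambda2 \<alpha> \<rho> j))
      = (\<Prod>k=1..m-1. r k) * (r m * lambda5 \<alpha> \<rho> m + s m * lambda6 \<alpha> \<rho> m - (lambda2 \<alpha> \<rho> m)\<^sup>2)"
    if m: "1 \<le> m" for m
  proof -
    let ?l = "(lambda2 \<alpha> \<rho> m)\<^sup>2" and ?p = "\<Prod>k=1..m-1. r k"
    have "0 < \<alpha> * \<rho> m" using pos m by blast
    note mix = lambda_mixture[of \<alpha> \<rho> m, OF this]
    have "r m * lambda3 \<alpha> \<rho> m * lambda2 \<alpha> \<rho> j + s m * lambda4 \<alpha> \<rho> m * lambda2 \<alpha> \<rho> j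
        - lambda2 \<alpha> \<rho> m * lambda2 \<alpha> \<rho> j = 0" for j
      using mix unfolding r_def s_def
      by (simp only: distrib_right[symmetric] left_diff_distrib[symmetric]) simp
    then have 1: "(\<Sum>j=m+1..M. r m * lambda3 \<alpha> \<rho> m * lambda2 \<alpha> \<rho> j
        + s m * lambda4 \<alpha> \<rho> m * lambda2 \<alpha> \<rho> j - lambda2 \<alpha> \<rho> m * lambda2 \<alpha> \<rho> j) = 0"
      by (intro sum.neutral) blast
    have "(\<Sum>j=1..m-1. s j * (\<Prod>k=1..j-1. r k) * ?l - (1 / 2) ^ j * ?l)
        = (\<Sum>j=1..m-1. (1 - r j) * (\<Prod>k=1..j-1. r k)) * ?l - (\<Sum>j=1..m-1. (1 / 2) ^ j) * ?l"
      unfolding sum_subtractf sum_distrib_right by (simp add: s)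
    also have "\<dots> = (2 * (1 / 2) ^ m - ?p) * ?l"
    proof -
      have "(1 / 2 :: real) ^ (m - 1) = 2 * (1 / 2) ^ m"
        using m by (cases m) simp_all
      then show ?thesis
        unfolding sum_split_prod sum_half_powers by (simp add: algebra_simps)
    qed
    finally have 2: "(\<Sum>j=1..m-1. s j * (\<Prod>k=1..j-1. r k) * ?l - (1 / 2) ^ j * ?l)
        = (2 * (1 / 2) ^ m - ?p) * ?l" .
    have 3: "(\<Prod>k=1..m. r k) = ?p * r m"
      using m by (cases m) simp_all
    show ?thesis unfolding 1 2 3 by (simp add: algebra_simps)
  qed
  then show ?thesis
    unfolding var_A_def var_B_def sum.distrib[symmetric]
    by (intro sum.cong refl) (simp add: r_def s_def)
qed

text \<open>Clipping changes the splits on a null set only, and makes all the functionals of the tree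
  bounded everywhere.\<close>

definition clip :: "real \<Rightarrow> real" where
  "clip y = (if 0 < y \<and> y < 1 then y else 1 / 2)"

lemma clip_measurable [measurable]: "clip \<in> borel_measurable borel"
  unfolding clip_def by measurable

context
  fixes P :: "'w measure" and M :: nat and \<alpha> :: real and \<rho> :: "nat \<Rightarrow> real"
    and Y :: "nat \<Rightarrow> nat \<Rightarrow> 'w \<Rightarrow> real"
  assumes P: "prob_space P" and pos: "\<forall>m\<ge>1. 0 < \<alpha> * \<rho> m"
    and Y: "branching_probabilities P M \<alpha> \<rho> Y"
begin

definition splits :: "'w \<Rightarrow> nat \<times> nat \<Rightarrow> real" where
  "splits \<omega> = (\<lambda>(m, i). Y m (2 * i - 1) \<omega>)"

lemma splits_distributed:
  "(m, i) \<in> nodes M \<Longrightarrow> distributed P lborel (\<lambda>\<omega>. splits \<omega> (m, i))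
    (\<lambda>x. ennreal (beta_density (\<alpha> * \<rho> m) (\<alpha> * \<rho> m) x))"
  using Y by (auto simp: branching_probabilities_def nodes_def splits_def)

lemma splits_indep: "prob_space.indep_vars P (\<lambda>_. borel) (\<lambda>k \<omega>. splits \<omega> k) (nodes M)"
proof -
  have "(\<lambda>k \<omega>. splits \<omega> k) = (\<lambda>(m, j). Y m (2 * j - 1))"
    by (auto simp: splits_def fun_eq_iff)
  then show ?thesis
    using Y by (simp add: branching_probabilities_def nodes_def)
qed

lemma splits_measurable: "k \<in> nodes M \<Longrightarrow> (\<lambda>\<omega>. splits \<omega> k) \<in> borel_measurable P"
  using splits_indep by (auto simp: prob_space.indep_vars_def[OF P])

lemma Y_eq_branch:
  assumes "\<omega> \<in> space P" "m \<in> {1..M}" "j \<in> {1..2 ^ m}"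
  shows "Y m j \<omega> = branch (splits \<omega>) m j"
proof -
  have i: "parent j \<in> {1..2 ^ (m - 1)}"
    using assms(2,3) parent_in[of j "m - 1"] by simp
  show ?thesis
  proof (cases "odd j")
    case True
    then have "2 * parent j - 1 = j" by (auto simp: parent_def)
    then show ?thesis using True by (simp add: branch_def splits_def)
  next
    case False
    then have "2 * parent j = j" by (auto simp: parent_def)
    then show ?thesis
      using False Y assms(1,2) i unfolding branching_probabilities_def
      by (metis branch_def splits_def case_prod_conv)
  qed
qed

lemma clip_splits_AE: "AE \<omega> in P. \<forall>k\<in>nodes M. clip (splits \<omega> k) = splits \<omega> k"
proof (rule AE_ball_countable')
  show "countable (nodes M)" by (simp add: nodes_def)
  fix k assume "k \<in> nodes M"
  then have "AE \<omega> in P. 0 < splits \<omega> k \<and> splits \<omega> k < 1"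
    using beta_distributed_AE[OF splits_distributed] by (cases k) auto
  then show "AE \<omega> in P. clip (splits \<omega> k) = splits \<omega> k"
    by eventually_elim (simp add: clip_def)
qed

lemma expectation_clip_splits:
  assumes k: "k \<in> nodes M" and g: "g \<in> borel_measurable borel"
    and I: "has_bochner_integral P (\<lambda>\<omega>. g (splits \<omega> k)) I"
  shows "(\<integral>\<omega>. g (clip (splits \<omega> k)) \<partial>P) = I"
proof -
  note [measurable] = g splits_measurable[OF k]
  have "(\<integral>\<omega>. g (clip (splits \<omega> k)) \<partial>P) = (\<integral>\<omega>. g (splits \<omega> k) \<partial>P)"
    using clip_splits_AE k by (intro integral_cong_AE) auto
  with I show ?thesis by (simp add: has_bochner_integral_iff)
qed

lemma splitting_tree_clip_splits:
  "splitting_tree P M (\<lambda>\<omega> k. clip (splits \<omega> k)) (lambda2 \<alpha> \<rho>)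
    (\<lambda>m. (\<alpha> * \<rho> m + 1) / (2 * \<alpha> * \<rho> m + 1) * lambda5 \<alpha> \<rho> m
       + (\<alpha> * \<rho> m) / (2 * \<alpha> * \<rho> m + 1) * lambda6 \<alpha> \<rho> m)
    (\<lambda>m. (\<alpha> * \<rho> m + 1) / (2 * \<alpha> * \<rho> m + 1))"
proof -
  interpret prob_space P by fact
  show ?thesis
  proof (unfold_locales, goal_cases)
    case 1
    show ?case using splits_indep by (rule indep_vars_compose2) simp
  next
    case (2 \<omega> k)
    show ?case by (simp add: clip_def)
  next
    case (3 m i)
    then have "0 < \<alpha> * \<rho> m" using pos by (auto simp: nodes_def)
    from has_bochner_integral_neg_entropy_beta[OF splits_distributed[OF 3] this]
    show ?case
      by (intro expectation_clip_splits 3) (simp_all add: lambda2_def mult.assoc)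
  next
    case (4 m i)
    then have "0 < \<alpha> * \<rho> m" using pos by (auto simp: nodes_def)
    from has_bochner_integral_neg_entropy_sq_beta[OF splits_distributed[OF 4] this]
    show ?case
      by (intro expectation_clip_splits[where g = "\<lambda>y. (neg_entropy y)\<^sup>2"] 4)
        (simp_all add: lambda5_def lambda6_def mult.assoc)
  next
    case (5 m i)
    then have "0 < \<alpha> * \<rho> m" using pos by (auto simp: nodes_def)
    from has_bochner_integral_sum_squares_beta[OF splits_distributed[OF 5] this]
    show ?case
      by (intro expectation_clip_splits[where g = "\<lambda>y. y\<^sup>2 + (1 - y)\<^sup>2"] 5) (simp_all add: mult.assoc)
  qed
qed

end

theorem proposition2:
  fixes P :: "'w measure" and M :: nat and \<alpha> :: real and \<rho> :: "nat \<Rightarrow> real"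
    and F0 :: "real measure" and f0 :: "real \<Rightarrow> real"
    and Y :: "nat \<Rightarrow> nat \<Rightarrow> 'w \<Rightarrow> real" and f :: "'w \<Rightarrow> real \<Rightarrow> real" and F :: "'w \<Rightarrow> real measure"
  assumes "prob_space P"
    and "M \<ge> 1" and "\<alpha> > 0" and "\<And>m. m \<ge> 1 \<Longrightarrow> \<rho> m > 0"
    and "prob_space F0" and "has_density F0 f0"
    and "finite_polya_tree P M \<alpha> \<rho> F0 f0 Y f F"
  shows "(AE \<omega> in P. integrable lborel (kl_integrand (f \<omega>) f0) \<and>
           kl (f \<omega>) f0 =
             (\<Sum>m=1..M. \<Sum>j=1..2 ^ m.
                ln (Y m j \<omega>) * (\<Prod>k=1..m. Y (m - k + 1) (ancestor m j (m - k + 1)) \<omega>))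
             + real M * ln 2)
         \<and> integrable P (\<lambda>\<omega>. kl (f \<omega>) f0)
         \<and> prob_space.expectation P (\<lambda>\<omega>. kl (f \<omega>) f0) =
              (\<Sum>m=1..M. Digamma (\<alpha> * \<rho> m + 1) - Digamma (2 * \<alpha> * \<rho> m + 1) + ln 2)
         \<and> integrable P (\<lambda>\<omega>. (kl (f \<omega>) f0)\<^sup>2)
         \<and> prob_space.variance P (\<lambda>\<omega>. kl (f \<omega>) f0) = var_A M \<alpha> \<rho> + var_B M \<alpha> \<rho>"
proof -
  have pos: "\<forall>m\<ge>1. 0 < \<alpha> * \<rho> m"
    using assms(3,4) by simp
  have Y: "branching_probabilities P M \<alpha> \<rho> Y"
    and f: "\<And>\<omega> x. \<omega> \<in> space P \<Longrightarrow> f \<omega> x = (\<Prod>m=1..M. Y m (cell_index F0 m x) \<omega>) * 2 ^ M * f0 x"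
    using assms(7) by (auto simp: finite_polya_tree_def)
  let ?y = "splits Y" and ?X = "\<lambda>\<omega> k. clip (splits Y \<omega> k)"
  let ?r = "\<lambda>m. (\<alpha> * \<rho> m + 1) / (2 * \<alpha> * \<rho> m + 1)"
  let ?s = "\<lambda>m. (\<alpha> * \<rho> m) / (2 * \<alpha> * \<rho> m + 1)"
  interpret splitting_tree P M ?X "lambda2 \<alpha> \<rho>"
    "\<lambda>m. ?r m * lambda5 \<alpha> \<rho> m + ?s m * lambda6 \<alpha> \<rho> m" ?r
    by (rule splitting_tree_clip_splits[OF assms(1) pos Y])
  let ?S = "\<lambda>\<omega>. \<Sum>n<M. level_entropy (?X \<omega>) n"
  let ?KL = "\<lambda>\<omega>. kl (f \<omega>) f0"
  note dist = has_density_distribution(1)[OF assms(5,6)]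

  have path: "(\<Prod>k=1..m. Y k (ancestor m j k) \<omega>) = mass (?y \<omega>) m j"
    if "\<omega> \<in> space P" "m \<le> M" "j \<in> {1..2 ^ m}" for \<omega> m j
    unfolding mass_eq_prod using that ancestor_in[of _ m j]
    by (intro prod.cong refl Y_eq_branch[OF assms(1) pos Y]) auto

  let ?c = "\<lambda>\<omega> j. mass (?y \<omega>) M j * 2 ^ M"
  have ratio: "f \<omega> x = ?c \<omega> j * f0 x"
    if \<omega>: "\<omega> \<in> space P" and j: "j \<in> {1..2 ^ M}" "x \<in> cell F0 M j" for \<omega> j x
  proof -
    have "(\<Prod>m=1..M. Y m (cell_index F0 m x) \<omega>) = (\<Prod>m=1..M. Y m (ancestor M j m) \<omega>)"
      by (intro prod.cong refl) (simp add: cell_index_eq[OF dist _ j])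
    then show ?thesis using f[OF \<omega>] path[OF \<omega> order_refl j(1)] by simp
  qed
  have kl_int: "integrable lborel (kl_integrand (f \<omega>) f0)" if "\<omega> \<in> space P" for \<omega>
    by (rule kl_piecewise_constant_ratio(1)[OF assms(5,6)]) (rule ratio[OF that])
  have kl_eq: "?KL \<omega> = (\<Sum>j=1..2 ^ M. ?c \<omega> j * ln (?c \<omega> j) / 2 ^ M)" if "\<omega> \<in> space P" for \<omega>
    by (rule kl_piecewise_constant_ratio(2)[OF assms(5,6)]) (rule ratio[OF that])

  have AE_KL: "AE \<omega> in P. ?KL \<omega> = ?S \<omega> + real M * ln 2 \<and>
      ?S \<omega> = (\<Sum>m=1..M. \<Sum>j=1..2 ^ m.
        ln (Y m j \<omega>) * (\<Prod>k=1..m. Y (m - k + 1) (ancestor m j (m - k + 1)) \<omega>))"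
    using clip_splits_AE[OF assms(1) pos Y] AE_space
  proof eventually_elim
    case (elim \<omega>)
    note \<omega> = elim(2)
    have eq: "U (?X \<omega>) = U (?y \<omega>)" if "determined_by U (nodes n)" "n \<le> M" for U n
      using that(1) by (rule determined_by_cong) (use elim(1) nodes_mono[OF that(2)] in auto)
    have mass: "mass (?X \<omega>) m j = mass (?y \<omega>) m j" if "m \<le> M" "j \<in> {1..2 ^ m}" for m j
      using eq[OF determined_by_mass[OF that(2)] that(1)] .
    have pos': "0 < mass (?X \<omega>) M j" for j
      using range by (intro mass_pos) auto
    have "?KL \<omega> = (\<Sum>j=1..2 ^ M. mass (?X \<omega>) M j * ln (mass (?X \<omega>) M j) + mass (?X \<omega>) M j * (real M * ln 2))"
      unfolding kl_eq[OF \<omega>]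
    proof (intro sum.cong refl)
      fix j :: nat assume "j \<in> {1..2 ^ M}"
      then have "mass (?y \<omega>) M j = mass (?X \<omega>) M j" by (simp add: mass)
      then show "?c \<omega> j * ln (?c \<omega> j) / 2 ^ M
          = mass (?X \<omega>) M j * ln (mass (?X \<omega>) M j) + mass (?X \<omega>) M j * (real M * ln 2)"
        using pos'[of j] by (simp add: ln_mult ln_realpow field_simps)
    qed
    also have "\<dots> = ?S \<omega> + real M * ln 2"
      unfolding sum.distrib sum_distrib_right[symmetric] sum_mass
      using sum_mass_ln_mass[of "?X \<omega>" M] range by simp
    finally have KL: "?KL \<omega> = ?S \<omega> + real M * ln 2" .
    have "(\<Sum>m=1..M. \<Sum>j=1..2 ^ m.
        ln (Y m j \<omega>) * (\<Prod>k=1..m. Y (m - k + 1) (ancestor m j (m - k + 1)) \<omega>))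
      = (\<Sum>m=1..M. \<Sum>j=1..2 ^ m. ln (branch (?y \<omega>) m j) * mass (?y \<omega>) m j)"
      unfolding prod_ancestors[of "\<lambda>m j. Y m j \<omega>"]
      by (intro sum.cong refl arg_cong2[where f = "(*)"] arg_cong[where f = ln] path[OF \<omega>]
          Y_eq_branch[OF assms(1) pos Y \<omega>]) auto
    also have "\<dots> = (\<Sum>n<M. \<Sum>j=1..2 ^ Suc n. ln (branch (?y \<omega>) (Suc n) j) * mass (?y \<omega>) (Suc n) j)"
      by (simp only: One_nat_def sum.atLeast1_atMost_eq)
    also have "\<dots> = ?S \<omega>"
      unfolding level_entropy_eq
      by (intro sum.cong refl eq[OF determined_by_level_entropy, symmetric]) auto
    finally show ?case using KL by simp
  qed

  have meas [measurable]: "?KL \<in> borel_measurable P"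
  proof -
    have [measurable]: "(\<lambda>\<omega>. mass (?y \<omega>) M j) \<in> borel_measurable P" if "j \<in> {1..2 ^ M}" for j
      using splits_measurable[OF assms(1) pos Y]
      by (intro determined_by_measurable[OF determined_by_mass[OF that]])
    have "(\<lambda>\<omega>. \<Sum>j=1..2 ^ M. ?c \<omega> j * ln (?c \<omega> j) / 2 ^ M) \<in> borel_measurable P"
      by measurable
    then show ?thesis
      by (subst measurable_cong[OF kl_eq])
  qed
  have S_meas [measurable]: "?S \<in> borel_measurable P"
    using integrable_entropy by (rule borel_measurable_integrable)
  have AE1: "AE \<omega> in P. ?KL \<omega> = ?S \<omega> + real M * ln 2"
    using AE_KL by eventually_elim simp
  have int1: "integrable P ?KL"
  proof (rule integrable_cong_AE_imp[OF _ meas])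
    show "integrable P (\<lambda>\<omega>. ?S \<omega> + real M * ln 2)"
      by (intro Bochner_Integration.integrable_add integrable_entropy integrable_const)
    show "AE \<omega> in P. ?S \<omega> + real M * ln 2 = ?KL \<omega>"
      using AE1 by eventually_elim simp
  qed
  have "expectation ?KL = expectation (\<lambda>\<omega>. ?S \<omega> + real M * ln 2)"
    by (intro integral_cong_AE AE1) measurable
  also have "\<dots> = expectation ?S + real M * ln 2"
    by (subst Bochner_Integration.integral_add[OF integrable_entropy integrable_const]) (simp add: prob_space)
  finally have E: "expectation ?KL = expectation ?S + real M * ln 2" .
  have int2: "integrable P (\<lambda>\<omega>. (?KL \<omega>)\<^sup>2)"
  proof (rule integrable_cong_AE_imp)
    show "integrable P (\<lambda>\<omega>. (?S \<omega>)\<^sup>2 + 2 * (real M * ln 2) * ?S \<omega> + (real M * ln 2)\<^sup>2)"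
      by (intro Bochner_Integration.integrable_add integrable_mult_right integrable_entropy
          integrable_entropy_sq integrable_const)
    show "AE \<omega> in P. (?S \<omega>)\<^sup>2 + 2 * (real M * ln 2) * ?S \<omega> + (real M * ln 2)\<^sup>2 = (?KL \<omega>)\<^sup>2"
      using AE1 by eventually_elim (simp add: power2_sum)
  qed measurable
  have "variance ?KL = variance ?S"
  proof (intro integral_cong_AE)
    show "AE \<omega> in P. (?KL \<omega> - expectation ?KL)\<^sup>2 = (?S \<omega> - expectation ?S)\<^sup>2"
      using AE1 by eventually_elim (simp add: E)
  qed measurable
  also have "\<dots> = var_A M \<alpha> \<rho> + var_B M \<alpha> \<rho>"
    unfolding variance_entropy var_A_plus_var_B[OF pos]
    by (simp add: sum.atLeast1_atMost_eq)
  finally have V: "variance ?KL = var_A M \<alpha> \<rho> + var_B M \<alpha> \<rho>" .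
  have "expectation ?KL = (\<Sum>m=1..M. Digamma (\<alpha> * \<rho> m + 1) - Digamma (2 * \<alpha> * \<rho> m + 1) + ln 2)"
    unfolding E expectation_entropy
    by (simp add: sum.atLeast1_atMost_eq sum.distrib lambda2_def)
  moreover have "AE \<omega> in P. integrable lborel (kl_integrand (f \<omega>) f0) \<and>
      ?KL \<omega> = (\<Sum>m=1..M. \<Sum>j=1..2 ^ m.
        ln (Y m j \<omega>) * (\<Prod>k=1..m. Y (m - k + 1) (ancestor m j (m - k + 1)) \<omega>)) + real M * ln 2"
    using AE_KL AE_space by eventually_elim (simp add: kl_int)
  ultimately show ?thesis
    using int1 int2 V by blast
qed

end
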